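(* Let $R$ be a representation set (complete set of representatives) of $\widehat{\mathcal T\mathcal F}/{\sim}$. Then the map $$\bigsqcup_{\rho\in R}\mathbb R^{d_2}/\mathcal G_\rho\to\operatorname{Ind}_{\mathcal T\mathcal F}^{\mathcal G}(\widehat{\mathcal T\mathcal F}),\qquad(\mathcal G_\rho\cdot k,\rho)\mapsto\operatorname{Ind}_{\mathcal T\mathcal F}^{\mathcal G}(\chi_k\rho),$$ where $\bigsqcup$ denotes the disjoint union, is (well-defined and) bijective.
   Context: $\mathbb N=\{1,2,\dots\}$. $E(d)=O(d)\ltimes\mathbb R^d$ is the Euclidean group: elements $(A,b)$ with product $(A_1,b_1)(A_2,b_2)=(A_1A_2,b_1+A_1b_2)$, acting on $\mathbb R^d$ by $(A,b)\cdot x=Ax+b$; write $L(A,b)=A$, $\tau(A,b)=b$. A translation is an element $(I_d,b)$. A $d$-dimensional space group is a discrete subgroup of $E(d)$ containing $d$ translations with linearly independent translation vectors. For $A_1\in O(d_1)$ and $(A_2,b_2)\in E(d_2)$ put $A_1\oplus(A_2,b_2):=\left(\begin{pmatrix}A_1&0\\ 0&A_2\end{pmatrix},\begin{pmatrix}0\\ b_2\end{pmatrix}\right)\in E(d_1+d_2)$. Setting: $d\in\mathbb N$, $d_1,d_2\in\mathbb N_0$ with $d=d_1+d_2$; $\mathcal S$ is a $d_2$-dimensional space group; $\mathcal G$ is a discrete subgroup of $O(d_1)\oplus\mathcal S=\{A\oplus g: A\in O(d_1),g\in\mathcal S\}$ (understood as $O(d)$ if $d_1=d$ and as $\mathcal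 S$ if $d_1=0$) such that $\pi(\mathcal G)=\mathcal S$, where $\pi(A\oplus g)=g$. $\mathcal F=\ker(\pi|_{\mathcal G})$; $\mathcal T_{\mathcal S}$ is the group of translations of $\mathcal S$. $\mathcal T\subset\mathcal G$ is a fixed subset such that $\pi|_{\mathcal T}:\mathcal T\to\mathcal T_{\mathcal S}$ is bijective ($\mathcal T$ need not be a group). $\mathcal T\mathcal F=\{tf:t\in\mathcal T,f\in\mathcal F\}=(\pi|_{\mathcal G})^{-1}(\mathcal T_{\mathcal S})$ is a normal subgroup of $\mathcal G$ of finite index. Representations: a representation of a group $\mathcal H$ is a homomorphism $\rho:\mathcal H\to U(d_\rho)$ into a finite-dimensional unitary group; equivalence is unitary equivalence; $\widehat{\mathcal H}$ is the set of equivalence classes of irreducible representations. $\mathcal G$ acts on $\widehat{\mathcal T\mathcal F}$ by $(g\cdot\rho)(n)=\rho(g^{-1}ng)$. For a subgroup $\mathcal K\le\mathcal H$ of finite index, $\operatorname{Ind}_{\mathcal K}^{\mathcal H}\rho$ is the usual induced (unitary) representation, regarded up to equivalence, and $\operatorname{Ind}_{\mathcal K}^{\mathcal H}(\widehat{\mathcal K})=\{\operatorname{Ind}_{\mathcal K}^{\mathcal H}\rho:\rho\in\widehat{\mathcal K}\}$. For $k\in\mathbb R^{d_2}$, $\chi_k\in\widehat{\mathcal T\mathcal F}$ is the one-dimensional representation $\chi_k(g)=\exp(2\pi i\langle k,\tau(\pi(g))\rangle)$. On $\widehat{\mathcal T\mathcal F}$ the equivalence relation $\sim$ is: $\rho\sim\rho'$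 iff there exist $g\in\mathcal G$ and $k\in\mathbb R^{d_2}$ with $g\cdot\rho=\chi_k\rho'$. For $\rho\in\widehat{\mathcal T\mathcal F}$, $\mathcal G_\rho:=\{(L(\pi(g)),k): g\in\mathcal G,\ k\in\mathbb R^{d_2},\ g\cdot\rho=\chi_k\rho\}\subset E(d_2)$, which is a subgroup of $E(d_2)$ (in fact a space group). $\mathbb R^{d_2}/\mathcal G_\rho$ is the set of orbits $\mathcal G_\rho\cdot k$ of $\mathbb R^{d_2}$ under $\mathcal G_\rho$. *)

theory Defs
  imports
    "HOL-Algebra.Coset"
    "Jordan_Normal_Form.VS_Connect"
    "Jordan_Normal_Form.Schur_Decomposition"
begin

section \<open>Euclidean groups\<close>

text \<open>
  The dimensions of the two summands may be zero, so vectors and matrices are those of the matrix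
  library with explicit dimensions; there is exactly one \<open>0 \<times> 0\<close> matrix and one vector
  of dimension \<open>0\<close>. The predicate \<^term>\<open>orthogonal_mat\<close> of that library only asks
  for \<open>A\<^sup>T A\<close> to be diagonal and is not the notion needed here.
\<close>

type_synonym isometry = "real mat \<times> real vec"

definition orth_mats :: "nat \<Rightarrow> real mat set" where
  "orth_mats d = {A \<in> carrier_mat d d. A * transpose_mat A = 1\<^sub>m d}"

definition euclid :: "nat \<Rightarrow> isometry monoid" where
  "euclid d =
     \<lparr>carrier = orth_mats d \<times> carrier_vec d,
      monoid.mult = (\<lambda>(A1, b1) (A2, b2). (A1 * A2, b1 + A1 *\<^sub>v b2)),
      monoid.one = (1\<^sub>m d, 0\<^sub>v d)\<rparr>"

abbreviation lin_part :: "isometry \<Rightarrow> real mat" where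
  "lin_part g \<equiv> fst g"

abbreviation trans_part :: "isometry \<Rightarrow> real vec" where
  "trans_part g \<equiv> snd g"

definition euclid_act :: "isometry \<Rightarrow> real vec \<Rightarrow> real vec" where
  "euclid_act g x = lin_part g *\<^sub>v x + trans_part g"

text \<open>
  The subspace topology inherited from \<open>\<real>\<^sup>d\<^sup>\<times>\<^sup>d \<times> \<real>\<^sup>d\<close> is discrete; closeness is measured in
  the maximum norm of the entries.
\<close>
definition discrete_isometries :: "nat \<Rightarrow> isometry set \<Rightarrow> bool" where
  "discrete_isometries d X \<longleftrightarrow>
     (\<forall>g\<in>X. \<exists>e>0. \<forall>h\<in>X.
        (\<forall>i<d. \<forall>j<d. \<bar>lin_part h $$ (i, j) - lin_part g $$ (i, j)\<bar> < e) \<and>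
        (\<forall>i<d. \<bar>trans_part h $ i - trans_part g $ i\<bar> < e) \<longrightarrow> h = g)"

definition translations_of :: "nat \<Rightarrow> isometry set \<Rightarrow> isometry set" where
  "translations_of d X = {g \<in> X. lin_part g = 1\<^sub>m d}"

definition space_group :: "nat \<Rightarrow> isometry set \<Rightarrow> bool" where
  "space_group d X \<longleftrightarrow>
     subgroup X (euclid d) \<and> discrete_isometries d X \<and>
     (\<exists>B. B \<subseteq> trans_part ` translations_of d X \<and> finite B \<and> card B = d \<and>
          \<not> module.lin_dep class_ring (module_vec TYPE(real) d) B)"

definition iso_dsum :: "nat \<Rightarrow> nat \<Rightarrow> real mat \<Rightarrow> isometry \<Rightarrow> isometry" where
  "iso_dsum d1 d2 A g =
     (four_block_mat A (0\<^sub>m d1 d2) (0\<^sub>m d2 d1) (lin_part g), 0\<^sub>v d1 @\<^sub>v trans_part g)"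

definition orth_dsum :: "nat \<Rightarrow> nat \<Rightarrow> isometry set \<Rightarrow> isometry set" where
  "orth_dsum d1 d2 X = {iso_dsum d1 d2 A g | A g. A \<in> orth_mats d1 \<and> g \<in> X}"

text \<open>
  The projection \<open>\<pi>\<close> with \<open>\<pi> (A \<oplus> g) = g\<close> reads off the lower right block and
  the last \<open>d2\<close> coordinates, see \<open>proj_iso_dsum\<close>.
\<close>
definition proj :: "nat \<Rightarrow> nat \<Rightarrow> isometry \<Rightarrow> isometry" where
  "proj d1 d2 g =
     (mat d2 d2 (\<lambda>(i, j). lin_part g $$ (d1 + i, d1 + j)), vec_last (trans_part g) d2)"

section \<open>Unitary representations\<close>

definition unitary_grp :: "nat \<Rightarrow> complex mat monoid" where
  "unitary_grp n =
     \<lparr>carrier = {U \<in> carrier_mat n n. U * mat_adjoint U = 1\<^sub>m n}, monoid.mult = (*), monoid.one = 1\<^sub>m n\<rparr>"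

text \<open>
  A representation of \<open>H\<close> of dimension \<open>n\<close> is an element of \<^term>\<open>hom H (unitary_grp n)\<close>.
  Values outside \<^term>\<open>carrier H\<close> are irrelevant: functions that agree on \<^term>\<open>carrier H\<close>
  are related by \<open>rep_equiv\<close>.
\<close>

definition rep_equiv :: "('a, 'm) monoid_scheme \<Rightarrow> (('a \<Rightarrow> complex mat) \<times> ('a \<Rightarrow> complex mat)) set" where
  "rep_equiv H =
     {(\<rho>, \<sigma>). \<exists>n. \<rho> \<in> hom H (unitary_grp n) \<and> \<sigma> \<in> hom H (unitary_grp n) \<and>
        (\<exists>U \<in> carrier (unitary_grp n). \<forall>h \<in> carrier H. \<sigma> h = U * \<rho> h * mat_adjoint U)}"

definition irreducible_rep :: "('a, 'm) monoid_scheme \<Rightarrow> ('a \<Rightarrow> complex mat) \<Rightarrow> bool" where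
  "irreducible_rep H \<rho> \<longleftrightarrow>
     (\<exists>n\<ge>1. \<rho> \<in> hom H (unitary_grp n) \<and>
        (\<forall>W. VectorSpace.subspace class_ring W (module_vec TYPE(complex) n) \<longrightarrow>
             (\<forall>h \<in> carrier H. \<forall>w \<in> W. \<rho> h *\<^sub>v w \<in> W) \<longrightarrow>
             W = {0\<^sub>v n} \<or> W = carrier_vec n))"

type_synonym 'a rep_class = "('a \<Rightarrow> complex mat) set"

definition dual :: "('a, 'm) monoid_scheme \<Rightarrow> 'a rep_class set" where
  "dual H = {\<rho>. irreducible_rep H \<rho>} // rep_equiv H"

text \<open>The map on equivalence classes induced by a map on representations compatible with equivalence.\<close>
definition on_classes ::
    "('a, 'm) monoid_scheme \<Rightarrow> (('a \<Rightarrow> complex mat) \<Rightarrow> ('a \<Rightarrow> complex mat)) \<Rightarrow> 'a rep_class \<Rightarrow> 'a rep_class" where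
  "on_classes H f c = (\<Union>\<rho>\<in>c. rep_equiv H `` {f \<rho>})"

definition left_transversal :: "('a, 'm) monoid_scheme \<Rightarrow> 'a set \<Rightarrow> 'a list \<Rightarrow> bool" where
  "left_transversal H K ts \<longleftrightarrow>
     set ts \<subseteq> carrier H \<and> (\<forall>x \<in> carrier H. \<exists>!i. i < length ts \<and> x \<in> (ts ! i) <#\<^bsub>H\<^esub> K)"

text \<open>
  The induced representation in matrix form: for left coset representatives \<open>t\<^sub>0, \<dots>, t\<^sub>m\<close> of \<open>K\<close>
  in \<open>H\<close>, the \<open>(p, q)\<close> block of its value at \<open>h\<close> is \<open>\<rho> (t\<^sub>p\<^sup>-\<^sup>1 h t\<^sub>q)\<close> if
  \<open>t\<^sub>p\<^sup>-\<^sup>1 h t\<^sub>q \<in> K\<close> and \<open>0\<close> otherwise.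
\<close>
definition ind_rep ::
    "('a, 'm) monoid_scheme \<Rightarrow> 'a set \<Rightarrow> 'a list \<Rightarrow> ('a \<Rightarrow> complex mat) \<Rightarrow> 'a \<Rightarrow> complex mat" where
  "ind_rep H K ts \<rho> h =
     (let n = dim_row (\<rho> \<one>\<^bsub>H\<^esub>) in
      mat (length ts * n) (length ts * n) (\<lambda>(i, j).
        let x = inv\<^bsub>H\<^esub> (ts ! (i div n)) \<otimes>\<^bsub>H\<^esub> h \<otimes>\<^bsub>H\<^esub> (ts ! (j div n))
        in if x \<in> K then \<rho> x $$ (i mod n, j mod n) else 0))"

text \<open>
  The class of the induced representation depends neither on the representation chosen from the class
  nor on the coset representatives, so the union is over one and the same class.
\<close>
definition Ind :: "('a, 'm) monoid_scheme \<Rightarrow> 'a set \<Rightarrow> 'a rep_class \<Rightarrow> 'a rep_class" where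
  "Ind H K c = (\<Union>ts \<in> {ts. left_transversal H K ts}. on_classes H (ind_rep H K ts) c)"

section \<open>Conjugation, twists and the groups \<open>\<G>\<^sub>\<rho>\<close>\<close>

text \<open>
  Below, \<open>G\<close> is a subgroup of \<^term>\<open>euclid (d1 + d2)\<close>, \<open>N\<close> a normal subgroup of \<open>G\<close>
  and \<open>c\<close> an element of the dual of \<open>N\<close>.
\<close>

abbreviation subgrp :: "nat \<Rightarrow> isometry set \<Rightarrow> isometry monoid" where
  "subgrp d X \<equiv> euclid d\<lparr>carrier := X\<rparr>"

definition conj_rep :: "nat \<Rightarrow> isometry \<Rightarrow> (isometry \<Rightarrow> complex mat) \<Rightarrow> isometry \<Rightarrow> complex mat" where
  "conj_rep d g \<rho> = (\<lambda>n. \<rho> (inv\<^bsub>euclid d\<^esub> g \<otimes>\<^bsub>euclid d\<^esub> n \<otimes>\<^bsub>euclid d\<^esub> g))"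

definition chi :: "nat \<Rightarrow> nat \<Rightarrow> real vec \<Rightarrow> isometry \<Rightarrow> complex" where
  "chi d1 d2 k g = exp (2 * complex_of_real pi * \<i> * complex_of_real (k \<bullet> trans_part (proj d1 d2 g)))"

definition twist_rep ::
    "nat \<Rightarrow> nat \<Rightarrow> real vec \<Rightarrow> (isometry \<Rightarrow> complex mat) \<Rightarrow> isometry \<Rightarrow> complex mat" where
  "twist_rep d1 d2 k \<rho> = (\<lambda>n. chi d1 d2 k n \<cdot>\<^sub>m \<rho> n)"

definition conj_class ::
    "nat \<Rightarrow> isometry set \<Rightarrow> isometry \<Rightarrow> isometry rep_class \<Rightarrow> isometry rep_class" where
  "conj_class d N g = on_classes (subgrp d N) (conj_rep d g)"

definition twist_class ::
    "nat \<Rightarrow> nat \<Rightarrow> isometry set \<Rightarrow> real vec \<Rightarrow> isometry rep_class \<Rightarrow> isometry rep_class" where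
  "twist_class d1 d2 N k = on_classes (subgrp (d1 + d2) N) (twist_rep d1 d2 k)"

definition dual_sim ::
    "nat \<Rightarrow> nat \<Rightarrow> isometry set \<Rightarrow> isometry set \<Rightarrow> (isometry rep_class \<times> isometry rep_class) set" where
  "dual_sim d1 d2 G N =
     {(c, c'). c \<in> dual (subgrp (d1 + d2) N) \<and> c' \<in> dual (subgrp (d1 + d2) N) \<and>
        (\<exists>g \<in> G. \<exists>k \<in> carrier_vec d2. conj_class (d1 + d2) N g c = twist_class d1 d2 N k c')}"

definition G_rho ::
    "nat \<Rightarrow> nat \<Rightarrow> isometry set \<Rightarrow> isometry set \<Rightarrow> isometry rep_class \<Rightarrow> isometry set" where
  "G_rho d1 d2 G N c =
     {(lin_part (proj d1 d2 g), k) | g k. g \<in> G \<and> k \<in> carrier_vec d2 \<and>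
        conj_class (d1 + d2) N g c = twist_class d1 d2 N k c}"

definition euclid_orbit :: "isometry set \<Rightarrow> real vec \<Rightarrow> real vec set" where
  "euclid_orbit X x = (\<lambda>g. euclid_act g x) ` X"

definition euclid_orbits :: "nat \<Rightarrow> isometry set \<Rightarrow> real vec set set" where
  "euclid_orbits d X = euclid_orbit X ` carrier_vec d"

section \<open>Basic facts\<close>

lemma proj_iso_dsum:
  assumes "A \<in> carrier_mat d1 d1" "g \<in> carrier_mat d2 d2 \<times> carrier_vec d2"
  shows "proj d1 d2 (iso_dsum d1 d2 A g) = g"
  using assms by (cases g) (auto simp: proj_def iso_dsum_def vec_last_def)

lemma orth_mats_transpose:
  assumes "A \<in> orth_mats d"
  shows "transpose_mat A * A = 1\<^sub>m d"
  using assms mat_mult_left_right_inverse[of A d "transpose_mat A"] by (auto simp: orth_mats_def)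

lemma group_euclid: "group (euclid d)"
proof (rule groupI)
  fix x y assume "x \<in> carrier (euclid d)" "y \<in> carrier (euclid d)"
  then obtain A a B b where xy: "x = (A, a)" "y = (B, b)"
      "A \<in> carrier_mat d d" "A * transpose_mat A = 1\<^sub>m d" "a \<in> carrier_vec d"
      "B \<in> carrier_mat d d" "B * transpose_mat B = 1\<^sub>m d" "b \<in> carrier_vec d"
    by (auto simp: euclid_def orth_mats_def)
  have "B * (transpose_mat B * transpose_mat A) = transpose_mat A"
    using xy by (subst assoc_mult_mat[symmetric, of _ d d _ d _ d]) auto
  then have "A * B * transpose_mat (A * B) = 1\<^sub>m d"
    using xy by (simp add: transpose_mult[of _ d d] assoc_mult_mat[of _ d d _ d _ d])
  with xy show "x \<otimes>\<^bsub>euclid d\<^esub> y \<in> carrier (euclid d)"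
    by (auto simp: euclid_def orth_mats_def)
next
  fix x assume "x \<in> carrier (euclid d)"
  then obtain A a where x: "x = (A, a)" "A \<in> orth_mats d" "A \<in> carrier_mat d d" "a \<in> carrier_vec d"
    by (auto simp: euclid_def orth_mats_def)
  let ?y = "(transpose_mat A, - (transpose_mat A *\<^sub>v a))"
  have "?y \<in> carrier (euclid d)" "?y \<otimes>\<^bsub>euclid d\<^esub> x = \<one>\<^bsub>euclid d\<^esub>"
    using x orth_mats_transpose[of A d]
    by (auto simp: euclid_def orth_mats_def uminus_l_inv_vec[of _ d])
  then show "\<exists>y\<in>carrier (euclid d). y \<otimes>\<^bsub>euclid d\<^esub> x = \<one>\<^bsub>euclid d\<^esub>" by blast
qed (auto simp: euclid_def orth_mats_def assoc_mult_mat[of _ d d _ d _ d]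
       mult_add_distrib_mat_vec[of _ d d] assoc_mult_mat_vec[of _ d d _ d] assoc_add_vec[of _ d])

end

theory Submission
  imports Defs "Jordan_Normal_Form.Spectral_Radius"
begin

text \<open>
  Restricted to a normal subgroup \<open>N\<close> of finite index, the representation induced from \<open>\<rho>\<close> is
  the direct sum of the conjugates of \<open>\<rho>\<close> by coset representatives. By Schur's lemma, irreducible
  representations of \<open>N\<close> therefore induce equivalent representations iff they are conjugate under
  the whole group. Here \<open>\<T>\<F>\<close> is the kernel of \<open>g \<mapsto> L (\<pi> g)\<close>, so it has finite
  index because the point group of a space group is finite. From \<open>g \<cdot> (\<chi>\<^sub>k \<rho>) = \<chi>\<^bsub>L(\<pi> g) k\<^esub> (g \<cdot> \<rho>)\<close>
  it follows that \<open>Ind (\<chi>\<^sub>k \<rho>) = Ind (\<chi>\<^sub>l \<rho>')\<close> iff \<open>g \<cdot> \<rho> = \<chi>\<^bsub>l - L(\<pi> g) k\<^esub> \<rho>'\<close>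
  for some \<open>g\<close>. For \<open>\<rho>, \<rho>' \<in> R\<close> this forces \<open>\<rho> = \<rho>'\<close>, and then it says that
  \<open>k\<close> and \<open>l\<close> lie in the same orbit of \<open>\<G>\<^sub>\<rho>\<close>.
\<close>

section \<open>Unitary groups and equivalence of representations\<close>

text \<open>\<open>Ind\<close> collects every transversal and every representative of a class, so a
  conjugation can be absorbed by moving the transversal, and two values of \<open>Ind\<close> can be
  compared through one common element. This is where finite index matters: without a finite
  transversal every \<open>Ind\<close> would be empty and could not tell classes apart. Induced
  representations are in general reducible, so Schur's lemma cannot be applied to them directly; it
  is applied to a single nonzero block of a unitary intertwiner. Such a block is neither unitary nor
  known to be square, which is why Schur's lemma takes a nonzero rectangular intertwiner and
  produces a unitary equivalence. Since \<T> need not be a group, the argument is carried out for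
  the kernel of the linear part, and \<T>\<F> is identified with that kernel only in the final
  theorem. The map is defined on orbits by choosing a point of each orbit; the description of orbits
  as fibres makes the choice harmless.\<close>

lemma mat_adjoint_eq_mat:
  fixes A :: "complex mat"
  shows "mat_adjoint A = mat (dim_col A) (dim_row A) (\<lambda>(i, j). cnj (A $$ (j, i)))"
  by (rule eq_matI) (auto simp: mat_adjoint_def mat_of_rows_index)

lemma mat_adjoint_carrier:
  "(A :: complex mat) \<in> carrier_mat n m \<Longrightarrow> mat_adjoint A \<in> carrier_mat m n"
  by (auto simp: mat_adjoint_eq_mat)

lemma mat_adjoint_index:
  "i < dim_col A \<Longrightarrow> j < dim_row A \<Longrightarrow> mat_adjoint (A :: complex mat) $$ (i, j) = cnj (A $$ (j, i))"
  by (auto simp: mat_adjoint_eq_mat)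

lemma mat_adjoint_adjoint [simp]: "mat_adjoint (mat_adjoint A) = (A :: complex mat)"
  by (rule eq_matI) (auto simp: mat_adjoint_eq_mat)

lemma mat_adjoint_one [simp]: "mat_adjoint (1\<^sub>m n :: complex mat) = 1\<^sub>m n"
  by (rule eq_matI) (auto simp: mat_adjoint_eq_mat)

lemma mat_adjoint_smult: "mat_adjoint (c \<cdot>\<^sub>m A) = cnj c \<cdot>\<^sub>m mat_adjoint (A :: complex mat)"
  by (rule eq_matI) (auto simp: mat_adjoint_eq_mat)

lemma mat_adjoint_mult:
  assumes "(A :: complex mat) \<in> carrier_mat n m" "B \<in> carrier_mat m p"
  shows "mat_adjoint (A * B) = mat_adjoint B * mat_adjoint A"
  using assms
  by (intro eq_matI) (auto simp: mat_adjoint_eq_mat scalar_prod_def mult.commute intro!: sum.cong)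

lemma unitary_grp_simps [simp]:
  "monoid.mult (unitary_grp n) = (*)" "monoid.one (unitary_grp n) = 1\<^sub>m n"
  by (simp_all add: unitary_grp_def)

lemma unitary_carrier_mat: "U \<in> carrier (unitary_grp n) \<Longrightarrow> U \<in> carrier_mat n n"
  by (simp add: unitary_grp_def)

lemma unitary_right: "U \<in> carrier (unitary_grp n) \<Longrightarrow> U * mat_adjoint U = 1\<^sub>m n"
  by (simp add: unitary_grp_def)

lemma unitary_left: "U \<in> carrier (unitary_grp n) \<Longrightarrow> mat_adjoint U * U = 1\<^sub>m n"
  using mat_mult_left_right_inverse[of U n "mat_adjoint U"] mat_adjoint_carrier[of U n n]
  by (auto simp: unitary_grp_def)

lemma unitary_adjoint: "U \<in> carrier (unitary_grp n) \<Longrightarrow> mat_adjoint U \<in> carrier (unitary_grp n)"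
  using unitary_left[of U n] mat_adjoint_carrier[of U n n] by (simp add: unitary_grp_def)

lemma unitary_mult:
  assumes "U \<in> carrier (unitary_grp n)" "V \<in> carrier (unitary_grp n)"
  shows "U * V \<in> carrier (unitary_grp n)"
proof -
  note c = unitary_carrier_mat[OF assms(1)] unitary_carrier_mat[OF assms(2)]
  note c = c c[THEN mat_adjoint_carrier]
  have "V * (mat_adjoint V * mat_adjoint U) = mat_adjoint U"
    using c unitary_right[OF assms(2)] by (subst assoc_mult_mat[symmetric, of _ n n _ n _ n]) simp_all
  then have "U * V * mat_adjoint (U * V) = 1\<^sub>m n"
    using c unitary_right[OF assms(1)]
    by (simp add: mat_adjoint_mult[of _ n n] assoc_mult_mat[of _ n n _ n _ n])
  with c show ?thesis by (simp add: unitary_grp_def)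
qed

lemma group_unitary_grp: "group (unitary_grp n)"
proof (rule groupI)
  fix U assume "U \<in> carrier (unitary_grp n)"
  then show "\<exists>V\<in>carrier (unitary_grp n). V \<otimes>\<^bsub>unitary_grp n\<^esub> U = \<one>\<^bsub>unitary_grp n\<^esub>"
    using unitary_adjoint unitary_left by fastforce
next
  fix U V W
  assume "U \<in> carrier (unitary_grp n)" "V \<in> carrier (unitary_grp n)" "W \<in> carrier (unitary_grp n)"
  then show "U \<otimes>\<^bsub>unitary_grp n\<^esub> V \<otimes>\<^bsub>unitary_grp n\<^esub> W = U \<otimes>\<^bsub>unitary_grp n\<^esub> (V \<otimes>\<^bsub>unitary_grp n\<^esub> W)"
    by (simp add: assoc_mult_mat[of _ n n _ n _ n] unitary_carrier_mat)
next
  fix U assume "U \<in> carrier (unitary_grp n)"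
  then show "\<one>\<^bsub>unitary_grp n\<^esub> \<otimes>\<^bsub>unitary_grp n\<^esub> U = U"
    using unitary_carrier_mat[of U n] by simp
qed (auto simp: unitary_mult, simp add: unitary_grp_def)

lemma inv_unitary_grp:
  assumes "U \<in> carrier (unitary_grp n)"
  shows "inv\<^bsub>unitary_grp n\<^esub> U = mat_adjoint U"
  using group.inv_equality[OF group_unitary_grp _ assms unitary_adjoint[OF assms]] unitary_left[OF assms]
  by simp

context
  fixes H :: "('a, 'm) monoid_scheme" and \<rho> :: "'a \<Rightarrow> complex mat" and n :: nat
  assumes H: "group H" and rep: "\<rho> \<in> hom H (unitary_grp n)"
begin

lemma rep_closed: "x \<in> carrier H \<Longrightarrow> \<rho> x \<in> carrier (unitary_grp n)"
  using rep by (auto simp: hom_def)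

lemma rep_carrier_mat: "x \<in> carrier H \<Longrightarrow> \<rho> x \<in> carrier_mat n n"
  using rep_closed unitary_carrier_mat by blast

lemma rep_mult: "x \<in> carrier H \<Longrightarrow> y \<in> carrier H \<Longrightarrow> \<rho> (x \<otimes>\<^bsub>H\<^esub> y) = \<rho> x * \<rho> y"
  using hom_mult[OF rep] by simp

lemma rep_one: "\<rho> \<one>\<^bsub>H\<^esub> = 1\<^sub>m n"
  using hom_one[OF rep H group_unitary_grp] by simp

lemma rep_inv: "x \<in> carrier H \<Longrightarrow> \<rho> (inv\<^bsub>H\<^esub> x) = mat_adjoint (\<rho> x)"
  using group_hom.hom_inv[of H "unitary_grp n" \<rho> x] H rep group_unitary_grp rep_closed
  by (simp add: group_hom_def group_hom_axioms_def inv_unitary_grp)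

end

text \<open>The value at the unit is an identity matrix, whose size is the dimension. This matches
  the dimensions that \<open>rep_equiv\<close> and \<open>irreducible_rep\<close> quantify
  existentially.\<close>

lemma rep_dim_unique:
  assumes "group H" "\<rho> \<in> hom H (unitary_grp n)" "\<rho> \<in> hom H (unitary_grp m)"
  shows "n = m"
  using rep_one[OF assms(1,2)] rep_one[OF assms(1,3)] by (metis index_one_mat(2))

text \<open>Irreducibility is not demanded, because \<open>rep_equiv\<close> must also serve as an
  equivalence relation on induced representations.\<close>

definition reps :: "('a, 'm) monoid_scheme \<Rightarrow> ('a \<Rightarrow> complex mat) set" where
  "reps H = {\<rho>. \<exists>n. \<rho> \<in> hom H (unitary_grp n)}"

lemma irreducible_rep_in_reps: "irreducible_rep H \<rho> \<Longrightarrow> \<rho> \<in> reps H"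
  by (auto simp: irreducible_rep_def reps_def)

lemma rep_equivI:
  assumes "\<rho> \<in> hom H (unitary_grp n)" "\<sigma> \<in> hom H (unitary_grp n)" "U \<in> carrier (unitary_grp n)"
    "\<And>h. h \<in> carrier H \<Longrightarrow> \<sigma> h = U * \<rho> h * mat_adjoint U"
  shows "(\<rho>, \<sigma>) \<in> rep_equiv H"
  unfolding rep_equiv_def using assms by blast

lemma equiv_rep_equiv:
  assumes H: "group H"
  shows "equiv (reps H) (rep_equiv H)"
proof (rule equivI)
  show "rep_equiv H \<subseteq> reps H \<times> reps H"
    by (auto simp: rep_equiv_def reps_def)
  show "refl_on (reps H) (rep_equiv H)"
  proof (rule refl_onI)
    fix \<rho> assume "\<rho> \<in> reps H"
    then obtain n where n: "\<rho> \<in> hom H (unitary_grp n)" by (auto simp: reps_def)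
    have "1\<^sub>m n \<in> carrier (unitary_grp n)" by (simp add: unitary_grp_def)
    moreover have "\<rho> h = 1\<^sub>m n * \<rho> h * mat_adjoint (1\<^sub>m n)" if "h \<in> carrier H" for h
      using rep_carrier_mat[OF H n that] by simp
    ultimately show "(\<rho>, \<rho>) \<in> rep_equiv H" using rep_equivI[OF n n] by blast
  qed
  show "sym (rep_equiv H)"
  proof (rule symI)
    fix \<rho> \<sigma> assume "(\<rho>, \<sigma>) \<in> rep_equiv H"
    then obtain n U where n: "\<rho> \<in> hom H (unitary_grp n)" "\<sigma> \<in> hom H (unitary_grp n)"
      and U: "U \<in> carrier (unitary_grp n)"
      and eq: "\<And>h. h \<in> carrier H \<Longrightarrow> \<sigma> h = U * \<rho> h * mat_adjoint U"
      by (auto simp: rep_equiv_def)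
    have "\<rho> h = mat_adjoint U * \<sigma> h * mat_adjoint (mat_adjoint U)" if h: "h \<in> carrier H" for h
    proof -
      note c = unitary_carrier_mat[OF U] mat_adjoint_carrier[OF unitary_carrier_mat[OF U]]
        rep_carrier_mat[OF H n(1) h]
      have "mat_adjoint U * (U * \<rho> h * mat_adjoint U) * U = (mat_adjoint U * U) * \<rho> h * (mat_adjoint U * U)"
        using c by (simp add: assoc_mult_mat[of _ n n _ n _ n])
      then show ?thesis using c unitary_left[OF U] by (simp add: eq[OF h])
    qed
    then show "(\<sigma>, \<rho>) \<in> rep_equiv H"
      using rep_equivI[OF n(2,1) unitary_adjoint[OF U]] by blast
  qed
  show "trans (rep_equiv H)"
  proof (rule transI)
    fix \<rho> \<sigma> \<tau> assume "(\<rho>, \<sigma>) \<in> rep_equiv H" "(\<sigma>, \<tau>) \<in> rep_equiv H"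
    then obtain n U m V where n: "\<rho> \<in> hom H (unitary_grp n)" "\<sigma> \<in> hom H (unitary_grp n)"
      and U: "U \<in> carrier (unitary_grp n)"
      and eq: "\<And>h. h \<in> carrier H \<Longrightarrow> \<sigma> h = U * \<rho> h * mat_adjoint U"
      and m: "\<sigma> \<in> hom H (unitary_grp m)" "\<tau> \<in> hom H (unitary_grp m)"
      and V: "V \<in> carrier (unitary_grp m)"
      and eq': "\<And>h. h \<in> carrier H \<Longrightarrow> \<tau> h = V * \<sigma> h * mat_adjoint V"
      by (auto simp: rep_equiv_def)
    have [simp]: "m = n" using rep_dim_unique[OF H m(1) n(2)] .
    have "\<tau> h = V * U * \<rho> h * mat_adjoint (V * U)" if h: "h \<in> carrier H" for h
    proof -
      note c = unitary_carrier_mat[OF U] unitary_carrier_mat[OF V[simplified]] rep_carrier_mat[OF H n(1) h]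
      note c = c c[THEN mat_adjoint_carrier]
      show ?thesis
        using c by (simp add: eq'[OF h] eq[OF h] mat_adjoint_mult[of _ n n] assoc_mult_mat[of _ n n _ n _ n])
    qed
    then show "(\<rho>, \<tau>) \<in> rep_equiv H"
      using n m V U unitary_mult[of V n U] by (auto simp: rep_equiv_def)
  qed
qed

text \<open>Identities between representations hold only on the carrier, so they give equivalence,
  with the identity matrix as intertwiner, rather than equality of functions. That \<sigma> is a
  homomorphism is inherited from \<rho>.\<close>

lemma rep_equiv_of_eq:
  assumes "group H" "\<rho> \<in> reps H" "\<And>h. h \<in> carrier H \<Longrightarrow> \<sigma> h = \<rho> h"
  shows "(\<rho>, \<sigma>) \<in> rep_equiv H"
proof -
  from assms(2) obtain n where n: "\<rho> \<in> hom H (unitary_grp n)" by (auto simp: reps_def)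
  have "1\<^sub>m n \<in> carrier (unitary_grp n)" by (simp add: unitary_grp_def)
  moreover have "\<sigma> h = 1\<^sub>m n * \<rho> h * mat_adjoint (1\<^sub>m n)" if "h \<in> carrier H" for h
    using rep_carrier_mat[OF assms(1) n that] assms(3)[OF that] by simp
  moreover have "\<sigma> \<in> hom H (unitary_grp n)"
    using n assms(1,3) by (auto simp: hom_def Pi_def group.is_monoid monoid.m_closed)
  ultimately show ?thesis using rep_equivI[OF n] by blast
qed

section \<open>Invariant subspaces and irreducibility\<close>

lemma subspace_module_vecI:
  assumes "W \<subseteq> carrier_vec n" "0\<^sub>v n \<in> W" "\<And>v w. v \<in> W \<Longrightarrow> w \<in> W \<Longrightarrow> v + w \<in> W"
    "\<And>c v. v \<in> W \<Longrightarrow> c \<cdot>\<^sub>v v \<in> W"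
  shows "VectorSpace.subspace class_ring W (module_vec TYPE('a :: field) n)"
  unfolding VectorSpace.subspace_def submodule_def
  using assms vec_vs[of n, where 'a = 'a] vec_module[of n, where 'a = 'a] by (simp add: module_vec_simps)

lemma subspace_module_vecD:
  assumes "VectorSpace.subspace class_ring W (module_vec TYPE('a :: field) n)"
  shows "W \<subseteq> carrier_vec n" "0\<^sub>v n \<in> W" "\<And>v w. v \<in> W \<Longrightarrow> w \<in> W \<Longrightarrow> v + w \<in> W"
    "\<And>c v. v \<in> W \<Longrightarrow> c \<cdot>\<^sub>v v \<in> W"
  using assms unfolding VectorSpace.subspace_def submodule_def
  by (simp_all add: module_vec_simps class_ring_simps)

lemma irreducible_repD:
  assumes "irreducible_rep H \<rho>" "group H" "\<rho> \<in> hom H (unitary_grp n)"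
  shows "n \<ge> 1"
    and "VectorSpace.subspace class_ring W (module_vec TYPE(complex) n) \<Longrightarrow>
         (\<And>h w. h \<in> carrier H \<Longrightarrow> w \<in> W \<Longrightarrow> \<rho> h *\<^sub>v w \<in> W) \<Longrightarrow> W = {0\<^sub>v n} \<or> W = carrier_vec n"
  using assms rep_dim_unique[OF assms(2) _ assms(3)] unfolding irreducible_rep_def by blast+

lemma irreducible_repI:
  assumes "n \<ge> 1" "\<rho> \<in> hom H (unitary_grp n)"
    "\<And>W. VectorSpace.subspace class_ring W (module_vec TYPE(complex) n) \<Longrightarrow>
      (\<And>h w. h \<in> carrier H \<Longrightarrow> w \<in> W \<Longrightarrow> \<rho> h *\<^sub>v w \<in> W) \<Longrightarrow> W = {0\<^sub>v n} \<or> W = carrier_vec n"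
  shows "irreducible_rep H \<rho>"
  unfolding irreducible_rep_def using assms by blast

text \<open>The intertwiner is taken in the direction from \<sigma> to \<rho>, so that it carries an
  invariant subspace of \<sigma> to one of \<rho>. Being invertible, it also reflects the two
  trivial cases.\<close>

lemma irreducible_rep_equiv:
  assumes H: "group H" and irr: "irreducible_rep H \<rho>" and eq: "(\<rho>, \<sigma>) \<in> rep_equiv H"
  shows "irreducible_rep H \<sigma>"
proof -
  have "(\<sigma>, \<rho>) \<in> rep_equiv H" using eq equiv_rep_equiv[OF H] by (meson equivE symD)
  then obtain n U where n: "\<rho> \<in> hom H (unitary_grp n)" "\<sigma> \<in> hom H (unitary_grp n)"
    and U: "U \<in> carrier (unitary_grp n)"
    and eq: "\<And>h. h \<in> carrier H \<Longrightarrow> \<rho> h = U * \<sigma> h * mat_adjoint U"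
    by (auto simp: rep_equiv_def)
  note Uc = unitary_carrier_mat[OF U] mat_adjoint_carrier[OF unitary_carrier_mat[OF U]]
  have UU: "mat_adjoint U *\<^sub>v (U *\<^sub>v w) = w" "U *\<^sub>v (mat_adjoint U *\<^sub>v w) = w" if "w \<in> carrier_vec n" for w
    using that Uc unitary_left[OF U] unitary_right[OF U]
    by (simp_all flip: assoc_mult_mat_vec[of _ n n _ n])
  have "W = {0\<^sub>v n} \<or> W = carrier_vec n"
    if W: "VectorSpace.subspace class_ring W (module_vec TYPE(complex) n)"
      and inv: "\<And>h w. h \<in> carrier H \<Longrightarrow> w \<in> W \<Longrightarrow> \<sigma> h *\<^sub>v w \<in> W" for W
  proof -
    note WD = subspace_module_vecD[OF W]
    define W' where "W' = (\<lambda>w. U *\<^sub>v w) ` W"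
    have "VectorSpace.subspace class_ring W' (module_vec TYPE(complex) n)"
    proof (rule subspace_module_vecI)
      show "W' \<subseteq> carrier_vec n" using Uc WD(1) by (auto simp: W'_def)
      show "0\<^sub>v n \<in> W'" using WD(2) Uc by (force simp: W'_def)
      show "v + w \<in> W'" if "v \<in> W'" "w \<in> W'" for v w
      proof -
        from that obtain v0 w0 where "v0 \<in> W" "w0 \<in> W" "v = U *\<^sub>v v0" "w = U *\<^sub>v w0"
          by (auto simp: W'_def)
        then have "v + w = U *\<^sub>v (v0 + w0)" "v0 + w0 \<in> W"
          using WD(1,3) Uc by (auto simp: mult_add_distrib_mat_vec subset_iff)
        then show ?thesis by (auto simp: W'_def)
      qed
      show "c \<cdot>\<^sub>v v \<in> W'" if "v \<in> W'" for c v
      proof -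
        from that obtain v0 where "v0 \<in> W" "v = U *\<^sub>v v0" by (auto simp: W'_def)
        then have "c \<cdot>\<^sub>v v = U *\<^sub>v (c \<cdot>\<^sub>v v0)" "c \<cdot>\<^sub>v v0 \<in> W"
          using WD(1,4) Uc by (auto simp: mult_mat_vec subset_iff)
        then show ?thesis by (auto simp: W'_def)
      qed
    qed
    moreover have "\<rho> h *\<^sub>v w \<in> W'" if h: "h \<in> carrier H" and "w \<in> W'" for h w
    proof -
      from that obtain w0 where w0: "w0 \<in> W" "w = U *\<^sub>v w0" by (auto simp: W'_def)
      with WD(1) have c: "w0 \<in> carrier_vec n" by auto
      note Sc = rep_carrier_mat[OF H n(2) h] and Uw = mult_mat_vec_carrier[OF Uc(1) c]
      have "\<rho> h *\<^sub>v w = (U * \<sigma> h) *\<^sub>v (mat_adjoint U *\<^sub>v w)"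
        unfolding eq[OF h] by (rule assoc_mult_mat_vec[OF mult_carrier_mat[OF Uc(1) Sc] Uc(2)]) (simp add: w0(2) Uw)
      also have "\<dots> = U *\<^sub>v (\<sigma> h *\<^sub>v w0)"
        using UU(1)[OF c] assoc_mult_mat_vec[OF Uc(1) Sc c] by (simp add: w0(2))
      finally show ?thesis using inv[OF h w0(1)] by (auto simp: W'_def)
    qed
    ultimately have "W' = {0\<^sub>v n} \<or> W' = carrier_vec n"
      using irreducible_repD(2)[OF irr H n(1)] by blast
    then show ?thesis
    proof
      assume "W' = {0\<^sub>v n}"
      then have "U *\<^sub>v w = 0\<^sub>v n" if "w \<in> W" for w using that by (auto simp: W'_def)
      then have "w = mat_adjoint U *\<^sub>v 0\<^sub>v n" if "w \<in> W" for w
        using UU(1)[of w] WD(1) that by auto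
      also have "mat_adjoint U *\<^sub>v 0\<^sub>v n = 0\<^sub>v n" using Uc by auto
      finally show ?thesis using WD(2) by blast
    next
      assume *: "W' = carrier_vec n"
      have "w \<in> W" if w: "w \<in> carrier_vec n" for w
      proof -
        have "U *\<^sub>v w \<in> W'" using * Uc w by auto
        then obtain w0 where "w0 \<in> W" "U *\<^sub>v w = U *\<^sub>v w0" by (auto simp: W'_def)
        then show ?thesis using UU(1)[OF w] UU(1)[of w0] WD(1) by auto
      qed
      then show ?thesis using WD(1) by auto
    qed
  qed
  then show ?thesis
    using irreducible_repI[OF irreducible_repD(1)[OF irr H n(1)] n(2)] by blast
qed

text \<open>Applies to conjugation, which permutes the image of \<open>\<rho>\<close>, and to twisting by scalars.\<close>
lemma irreducible_rep_transfer:
  assumes H: "group H" and irr: "irreducible_rep H \<rho>"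
    and \<rho>: "\<rho> \<in> hom H (unitary_grp n)" and \<sigma>: "\<sigma> \<in> hom H (unitary_grp n)"
    and eq: "\<And>h. h \<in> carrier H \<Longrightarrow> \<exists>h'\<in>carrier H. \<exists>c. \<rho> h = c \<cdot>\<^sub>m \<sigma> h'"
  shows "irreducible_rep H \<sigma>"
proof (rule irreducible_repI[OF irreducible_repD(1)[OF irr H \<rho>] \<sigma>])
  fix W
  assume W: "VectorSpace.subspace class_ring W (module_vec TYPE(complex) n)"
    and inv: "\<And>h w. h \<in> carrier H \<Longrightarrow> w \<in> W \<Longrightarrow> \<sigma> h *\<^sub>v w \<in> W"
  have "\<rho> h *\<^sub>v w \<in> W" if "h \<in> carrier H" "w \<in> W" for h w
  proof -
    from eq[OF that(1)] obtain h' c where h': "h' \<in> carrier H" "\<rho> h = c \<cdot>\<^sub>m \<sigma> h'" by blast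
    have "w \<in> carrier_vec n" using subspace_module_vecD(1)[OF W] that by blast
    then have "\<rho> h *\<^sub>v w = c \<cdot>\<^sub>v (\<sigma> h' *\<^sub>v w)"
      using rep_carrier_mat[OF H \<sigma> h'(1)] by (intro eq_vecI) (auto simp: h'(2))
    then show ?thesis using subspace_module_vecD(4)[OF W] inv[OF h'(1) that(2)] by simp
  qed
  then show "W = {0\<^sub>v n} \<or> W = carrier_vec n"
    using irreducible_repD(2)[OF irr H \<rho> W] by blast
qed

section \<open>Classes in the dual and maps between them\<close>

lemma dual_cases:
  assumes "c \<in> dual H"
  obtains \<rho> where "irreducible_rep H \<rho>" "c = rep_equiv H `` {\<rho>}"
  using assms by (auto simp: dual_def quotient_def)

lemma dualI: "irreducible_rep H \<rho> \<Longrightarrow> rep_equiv H `` {\<rho>} \<in> dual H"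
  by (auto simp: dual_def quotient_def)

text \<open>Compatibility with equivalence makes all classes in the union equal, and reflexivity
  makes the union nonempty.\<close>

lemma on_classes_class:
  assumes H: "group H" and K: "group K" and \<rho>: "\<rho> \<in> reps H"
    and resp: "\<And>\<sigma>. (\<rho>, \<sigma>) \<in> rep_equiv H \<Longrightarrow> (f \<rho>, f \<sigma>) \<in> rep_equiv K"
  shows "on_classes K f (rep_equiv H `` {\<rho>}) = rep_equiv K `` {f \<rho>}"
proof -
  have "rep_equiv K `` {f \<sigma>} = rep_equiv K `` {f \<rho>}" if "(\<rho>, \<sigma>) \<in> rep_equiv H" for \<sigma>
    using equiv_class_eq[OF equiv_rep_equiv[OF K] resp[OF that]] by simp
  moreover have "(\<rho>, \<rho>) \<in> rep_equiv H"
    using equiv_rep_equiv[OF H] \<rho> by (meson equivE refl_onD)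
  ultimately show ?thesis unfolding on_classes_def by blast
qed

section \<open>Schur's lemma\<close>

lemma mat_eqI_mult_vec:
  assumes "A \<in> carrier_mat m n" "B \<in> carrier_mat m n"
    and eq: "\<And>v. v \<in> carrier_vec n \<Longrightarrow> A *\<^sub>v v = B *\<^sub>v (v :: 'a :: semiring_1 vec)"
  shows "A = B"
proof (rule eq_matI)
  fix i j assume "i < dim_row B" "j < dim_col B"
  with assms have ij: "i < m" "j < n" by auto
  have "(A *\<^sub>v unit_vec n j) $ i = (B *\<^sub>v unit_vec n j) $ i"
    using eq[of "unit_vec n j"] by simp
  with ij assms(1,2) show "A $$ (i, j) = B $$ (i, j)" by simp
qed (use assms in auto)

text \<open>Over the complex numbers and in positive dimension, X has an eigenvector. Its eigenspace
  is nonzero, and invariant because X commutes with \<rho>, so it is the whole space.\<close>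

lemma irreducible_commuting_scalar:
  assumes H: "group H" and irr: "irreducible_rep H \<rho>" and \<rho>: "\<rho> \<in> hom H (unitary_grp n)"
    and X: "X \<in> carrier_mat n n"
    and comm: "\<And>h. h \<in> carrier H \<Longrightarrow> \<rho> h * X = X * \<rho> h"
  obtains c where "X = c \<cdot>\<^sub>m 1\<^sub>m n"
proof -
  have "n > 0" using irreducible_repD(1)[OF irr H \<rho>] by simp
  from spectrum_non_empty[OF X this] obtain c v where v: "eigenvector X v c"
    by (auto simp: spectrum_def eigenvalue_def)
  define W where "W = {w \<in> carrier_vec n. X *\<^sub>v w = c \<cdot>\<^sub>v w}"
  have "VectorSpace.subspace class_ring W (module_vec TYPE(complex) n)"
  proof (rule subspace_module_vecI)
    show "0\<^sub>v n \<in> W" using X by (auto simp: W_def)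
    show "w + w' \<in> W" if "w \<in> W" "w' \<in> W" for w w'
      using that X by (auto simp: W_def mult_add_distrib_mat_vec[OF X] smult_add_distrib_vec[of _ n])
    show "a \<cdot>\<^sub>v w \<in> W" if "w \<in> W" for a w
      using that X by (auto simp: W_def mult_mat_vec[OF X] smult_smult_assoc mult.commute)
  qed (auto simp: W_def)
  moreover have "\<rho> h *\<^sub>v w \<in> W" if h: "h \<in> carrier H" and w: "w \<in> W" for h w
  proof -
    note \<rho>h = rep_carrier_mat[OF H \<rho> h]
    from w have w: "w \<in> carrier_vec n" "X *\<^sub>v w = c \<cdot>\<^sub>v w" by (auto simp: W_def)
    have "X *\<^sub>v (\<rho> h *\<^sub>v w) = \<rho> h *\<^sub>v (X *\<^sub>v w)"
      using assoc_mult_mat_vec[OF X \<rho>h w(1)] assoc_mult_mat_vec[OF \<rho>h X w(1)] comm[OF h] by simp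
    also have "\<dots> = c \<cdot>\<^sub>v (\<rho> h *\<^sub>v w)" using mult_mat_vec[OF \<rho>h w(1)] w(2) by simp
    finally show ?thesis using mult_mat_vec_carrier[OF \<rho>h w(1)] by (simp add: W_def)
  qed
  ultimately have "W = {0\<^sub>v n} \<or> W = carrier_vec n" using irreducible_repD(2)[OF irr H \<rho>] by blast
  moreover have "v \<in> W" "v \<noteq> 0\<^sub>v n" using v X by (auto simp: eigenvector_def W_def)
  ultimately have W: "W = carrier_vec n" by blast
  have "X = c \<cdot>\<^sub>m 1\<^sub>m n"
  proof (rule mat_eqI_mult_vec[OF X])
    fix w :: "complex vec" assume w: "w \<in> carrier_vec n"
    then have "X *\<^sub>v w = c \<cdot>\<^sub>v w" using W by (auto simp: W_def)
    also have "c \<cdot>\<^sub>v w = (c \<cdot>\<^sub>m 1\<^sub>m n) *\<^sub>v w" using w by (intro eq_vecI) auto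
    finally show "X *\<^sub>v w = (c \<cdot>\<^sub>m 1\<^sub>m n) *\<^sub>v w" .
  qed simp
  then show ?thesis by (rule that)
qed

lemma smult_smult_mat: "a \<cdot>\<^sub>m (b \<cdot>\<^sub>m A) = (a * b) \<cdot>\<^sub>m (A :: 'a :: semigroup_mult mat)"
  by (rule eq_matI) (auto simp: mult.assoc)

lemma one_smult_mat: "1 \<cdot>\<^sub>m A = (A :: 'a :: monoid_mult mat)"
  by (rule eq_matI) auto

text \<open>The adjoint of M intertwines in the opposite direction, so both products of M with its
  adjoint commute with an irreducible representation and are scalar. Rescaling M by the inverse
  square root of this scalar makes it unitary.\<close>

lemma schur_unitary_equiv:
  assumes H: "group H" and irr: "irreducible_rep H \<rho>" "irreducible_rep H \<sigma>"
    and \<rho>: "\<rho> \<in> hom H (unitary_grp n)" and \<sigma>: "\<sigma> \<in> hom H (unitary_grp m)"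
    and M: "M \<in> carrier_mat m n" and i: "i < m" and j: "j < n" and nz: "M $$ (i, j) \<noteq> 0"
    and inter: "\<And>h. h \<in> carrier H \<Longrightarrow> \<sigma> h * M = M * \<rho> h"
  shows "(\<rho>, \<sigma>) \<in> rep_equiv H"
proof -
  let ?A = "mat_adjoint M"
  have A: "?A \<in> carrier_mat n m" using M by (rule mat_adjoint_carrier)
  \<comment> \<open>The adjoint of the intertwining relation at the inverse of h, where unitarity
    turns values at inverses into adjoints.\<close>
  have inter': "\<rho> h * ?A = ?A * \<sigma> h" if h: "h \<in> carrier H" for h
  proof -
    have h': "inv\<^bsub>H\<^esub> h \<in> carrier H" using H h by simp
    have eq: "\<rho> (inv\<^bsub>H\<^esub> h) = mat_adjoint (\<rho> h)" "\<sigma> (inv\<^bsub>H\<^esub> h) = mat_adjoint (\<sigma> h)"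
      using rep_inv[OF H \<rho> h] rep_inv[OF H \<sigma> h] by auto
    show ?thesis
      using arg_cong[OF inter[OF h'], of mat_adjoint] 
        mat_adjoint_mult[OF rep_carrier_mat[OF H \<sigma> h'] M] mat_adjoint_mult[OF M rep_carrier_mat[OF H \<rho> h']]
      by (simp add: eq)
  qed
  have "\<rho> h * (?A * M) = ?A * M * \<rho> h" if h: "h \<in> carrier H" for h
  proof -
    note \<rho>h = rep_carrier_mat[OF H \<rho> h] and \<sigma>h = rep_carrier_mat[OF H \<sigma> h]
    have "\<rho> h * (?A * M) = ?A * \<sigma> h * M"
      using assoc_mult_mat[OF \<rho>h A M] inter'[OF h] by simp
    also have "\<dots> = ?A * M * \<rho> h"
      using assoc_mult_mat[OF A \<sigma>h M] assoc_mult_mat[OF A M \<rho>h] inter[OF h] by simp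
    finally show ?thesis .
  qed
  then obtain c where c: "?A * M = c \<cdot>\<^sub>m 1\<^sub>m n"
    using irreducible_commuting_scalar[OF H irr(1) \<rho> mult_carrier_mat[OF A M]] by blast
  have "\<sigma> h * (M * ?A) = M * ?A * \<sigma> h" if h: "h \<in> carrier H" for h
  proof -
    note \<rho>h = rep_carrier_mat[OF H \<rho> h] and \<sigma>h = rep_carrier_mat[OF H \<sigma> h]
    have "\<sigma> h * (M * ?A) = M * \<rho> h * ?A"
      using assoc_mult_mat[OF \<sigma>h M A] inter[OF h] by simp
    also have "\<dots> = M * ?A * \<sigma> h"
      using assoc_mult_mat[OF M \<rho>h A] assoc_mult_mat[OF M A \<sigma>h] inter'[OF h] by simp
    finally show ?thesis .
  qed
  then obtain c' where c': "M * ?A = c' \<cdot>\<^sub>m 1\<^sub>m m"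
    using irreducible_commuting_scalar[OF H irr(2) \<sigma> mult_carrier_mat[OF M A]] by blast
  \<comment> \<open>The two scalars agree, since both multiply the nonzero matrix M to the same
    result.\<close>
  have "M * (?A * M) = M * ?A * M" using assoc_mult_mat[OF M A M] by simp
  then have "c \<cdot>\<^sub>m M = c' \<cdot>\<^sub>m M"
    using M by (simp add: c c' mult_smult_distrib[OF M one_carrier_mat] mult_smult_assoc_mat[of _ m m])
  then have "(c \<cdot>\<^sub>m M) $$ (i, j) = (c' \<cdot>\<^sub>m M) $$ (i, j)" by simp
  then have [simp]: "c' = c" using nz i j M by simp
  \<comment> \<open>Diagonal entries of the two products: c is the squared norm of every column and
    of every row of M. Column \<open>j\<close> contains a nonzero entry, which makes c a positive
    real number.\<close>
  have col: "c = (\<Sum>a<m. complex_of_real ((cmod (M $$ (a, b)))\<^sup>2))" if b: "b < n" for b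
  proof -
    have "c = (?A * M) $$ (b, b)" using b by (simp add: c)
    also have "\<dots> = (\<Sum>a<m. cnj (M $$ (a, b)) * M $$ (a, b))"
      using b M A by (simp add: scalar_prod_def mat_adjoint_index lessThan_atLeast0)
    finally show ?thesis by (simp add: complex_norm_square mult.commute del: of_real_power)
  qed
  have row: "c = (\<Sum>b<n. complex_of_real ((cmod (M $$ (a, b)))\<^sup>2))" if a: "a < m" for a
  proof -
    have "c = (M * ?A) $$ (a, a)" using a by (simp add: c')
    also have "\<dots> = (\<Sum>b<n. M $$ (a, b) * cnj (M $$ (a, b)))"
      using a M A by (simp add: scalar_prod_def mat_adjoint_index lessThan_atLeast0)
    finally show ?thesis by (simp add: complex_norm_square del: of_real_power)
  qed
  define r where "r = (\<Sum>a<m. (cmod (M $$ (a, j)))\<^sup>2)"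
  have r: "c = complex_of_real r" using col[OF j] by (simp add: r_def)
  have "0 < r" unfolding r_def using i nz by (intro sum_pos2[of _ i]) auto
  \<comment> \<open>Double counting of the squared moduli of all entries, by columns and by rows; as
    c is nonzero, M is square.\<close>
  have "of_nat n * c = (\<Sum>b<n. c)" by simp
  also have "\<dots> = (\<Sum>b<n. \<Sum>a<m. complex_of_real ((cmod (M $$ (a, b)))\<^sup>2))"
    by (intro sum.cong refl col) simp
  also have "\<dots> = (\<Sum>a<m. \<Sum>b<n. complex_of_real ((cmod (M $$ (a, b)))\<^sup>2))"
    by (rule sum.swap)
  also have "\<dots> = (\<Sum>a<m. c)" by (intro sum.cong refl row[symmetric]) simp
  also have "\<dots> = of_nat m * c" by simp
  finally have [simp]: "m = n" using \<open>0 < r\<close> r by simp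
  \<comment> \<open>A real scale with \<open>s * s * c = 1\<close>; being real, it equals its
    conjugate and so enters the adjoint unchanged.\<close>
  define s where "s = complex_of_real (1 / sqrt r)"
  have s: "cnj s = s" "s * s * c = 1"
    using \<open>0 < r\<close> by (simp_all add: s_def r flip: of_real_mult)
  have "s \<cdot>\<^sub>m M * mat_adjoint (s \<cdot>\<^sub>m M) = (s * s) \<cdot>\<^sub>m (M * ?A)"
    using M A by (simp add: mat_adjoint_smult s mult_smult_distrib[of _ n n] mult_smult_assoc_mat[of _ n n] smult_smult_mat)
  also have "\<dots> = 1\<^sub>m n" using s(2) by (simp add: c' smult_smult_mat one_smult_mat)
  finally have U: "s \<cdot>\<^sub>m M \<in> carrier (unitary_grp n)" using M by (simp add: unitary_grp_def)
  have "\<sigma> h = s \<cdot>\<^sub>m M * \<rho> h * mat_adjoint (s \<cdot>\<^sub>m M)" if h: "h \<in> carrier H" for h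
  proof -
    note \<rho>h = rep_carrier_mat[OF H \<rho> h] and \<sigma>h = rep_carrier_mat[OF H \<sigma> h]
    have "s \<cdot>\<^sub>m M * \<rho> h * mat_adjoint (s \<cdot>\<^sub>m M) = (s * s) \<cdot>\<^sub>m (M * \<rho> h * ?A)"
      using M A \<rho>h mult_carrier_mat[OF M \<rho>h]
      by (simp add: mat_adjoint_smult s mult_smult_distrib[of _ n n] mult_smult_assoc_mat[of _ n n] smult_smult_mat)
    also have "M * \<rho> h * ?A = \<sigma> h * (M * ?A)"
      using assoc_mult_mat[OF \<sigma>h M A] inter[OF h] by simp
    also have "\<dots> = c \<cdot>\<^sub>m \<sigma> h"
      using \<sigma>h mult_smult_distrib[of "\<sigma> h" n n "1\<^sub>m n" n c] by (simp add: c')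
    finally show ?thesis using s(2) \<sigma>h by (simp add: smult_smult_mat one_smult_mat)
  qed
  then show ?thesis using rep_equivI[OF \<rho> _ U] \<sigma> by simp
qed

section \<open>Induced representations\<close>

lemma sum_lessThan_blocks:
  "(\<Sum>k<m * n. f k) = (\<Sum>q<m. \<Sum>c<n. f (q * n + c))" for f :: "nat \<Rightarrow> 'a :: comm_monoid_add"
proof -
  have "(\<Sum>c<n. f (q * n + c)) = sum f {q * n..<q * n + n}" for q
    using sum.shift_bounds_nat_ivl[of f 0 "q * n" n] by (simp add: lessThan_atLeast0 add.commute)
  then show ?thesis using sum.nat_group[of f n m] by simp
qed

text \<open>The index \<open>q * n + c\<close> is position c inside block q, the inverse of the
  splitting by \<open>div\<close> and \<open>mod\<close> in \<open>ind_rep\<close>.\<close>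

lemma mult_mat_index_blocks:
  assumes "A \<in> carrier_mat r (m * n)" "B \<in> carrier_mat (m * n) s" "i < r" "j < s"
  shows "(A * B) $$ (i, j) = (\<Sum>q<m. \<Sum>c<n. A $$ (i, q * n + c) * B $$ (q * n + c, j))"
proof -
  have "(A * B) $$ (i, j) = (\<Sum>k<m * n. A $$ (i, k) * B $$ (k, j))"
    using assms by (simp add: scalar_prod_def lessThan_atLeast0)
  then show ?thesis by (simp add: sum_lessThan_blocks)
qed

lemma block_index_less: "p < m \<Longrightarrow> a < n \<Longrightarrow> p * n + a < m * (n :: nat)"
  by (metis add.commute add_mult_distrib less_le_trans mult_le_mono1 mult_Suc nat_add_left_cancel_less plus_1_eq_Suc Suc_leI)

lemma div_less_blocks: "i < m * n \<Longrightarrow> i div n < (m :: nat)"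
  by (simp add: less_mult_imp_div_less)

lemma mod_less_blocks: "i < m * n \<Longrightarrow> i mod n < (n :: nat)"
  by (metis mod_less_divisor mult_0_right not_gr_zero not_less_zero)

lemma (in group) in_l_coset_iff:
  assumes "subgroup K G" "t \<in> carrier G" "x \<in> carrier G"
  shows "x \<in> t <# K \<longleftrightarrow> inv t \<otimes> x \<in> K"
proof
  assume "x \<in> t <# K"
  then obtain k where k: "k \<in> K" "x = t \<otimes> k" by (auto simp: l_coset_def)
  then have "k \<in> carrier G" using assms(1) subgroup.mem_carrier by fast
  then show "inv t \<otimes> x \<in> K" using k assms(2) by (simp add: m_assoc[symmetric])
next
  assume *: "inv t \<otimes> x \<in> K"
  have "x = t \<otimes> (inv t \<otimes> x)" using assms by (simp add: m_assoc[symmetric])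
  with * show "x \<in> t <# K" by (auto simp: l_coset_def)
qed

section \<open>Block structure of an induced representation\<close>

context
  fixes H :: "('a, 'm) monoid_scheme" and K :: "'a set" and ts :: "'a list"
  assumes H: "group H" and K: "subgroup K H" and ts: "left_transversal H K ts"
begin

interpretation group H by (rule H)

lemma transversal_closed: "p < length ts \<Longrightarrow> ts ! p \<in> carrier H"
  using ts by (auto simp: left_transversal_def)

text \<open>The form in which cosets enter \<open>ind_rep\<close>. For x the product of h with a
  representative, it says that in each block column exactly one block is given by a value of \<rho>
  and the others are 0.\<close>

lemma transversal_ex1:
  assumes "x \<in> carrier H"
  shows "\<exists>!q. q < length ts \<and> inv\<^bsub>H\<^esub> (ts ! q) \<otimes>\<^bsub>H\<^esub> x \<in> K"
proof -
  have "\<exists>!q. q < length ts \<and> x \<in> (ts ! q) <#\<^bsub>H\<^esub> K"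
    using ts assms by (auto simp: left_transversal_def)
  moreover have "x \<in> (ts ! q) <#\<^bsub>H\<^esub> K \<longleftrightarrow> inv\<^bsub>H\<^esub> (ts ! q) \<otimes>\<^bsub>H\<^esub> x \<in> K" if "q < length ts" for q
    using in_l_coset_iff[OF K transversal_closed[OF that] assms] .
  ultimately show ?thesis by (metis (no_types, lifting))
qed

lemma transversal_eq:
  assumes "p < length ts" "q < length ts"
  shows "inv\<^bsub>H\<^esub> (ts ! p) \<otimes>\<^bsub>H\<^esub> (ts ! q) \<in> K \<longleftrightarrow> p = q"
proof -
  have "inv\<^bsub>H\<^esub> (ts ! q) \<otimes>\<^bsub>H\<^esub> (ts ! q) \<in> K"
    using transversal_closed[OF assms(2)] subgroup.one_closed[OF K] by simp
  then show ?thesis using transversal_ex1[OF transversal_closed[OF assms(2)]] assms by blast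
qed

lemma transversal_nonempty: "length ts > 0"
  using transversal_ex1[OF one_closed] by auto

context
  fixes \<rho> :: "'a \<Rightarrow> complex mat" and n :: nat
  assumes \<rho>: "\<rho> \<in> hom (H\<lparr>carrier := K\<rparr>) (unitary_grp n)"
begin

lemma group_K: "group (H\<lparr>carrier := K\<rparr>)"
  using subgroup.subgroup_is_group[OF K H] .

lemma dim_rep_one: "dim_row (\<rho> \<one>\<^bsub>H\<^esub>) = n"
  using rep_one[OF group_K \<rho>] by simp

lemma ind_rep_carrier: "ind_rep H K ts \<rho> x \<in> carrier_mat (length ts * n) (length ts * n)"
  by (simp add: ind_rep_def Let_def dim_rep_one)

lemma ind_rep_index:
  assumes "i < length ts * n" "j < length ts * n"
  shows "ind_rep H K ts \<rho> x $$ (i, j) =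
    (if inv\<^bsub>H\<^esub> (ts ! (i div n)) \<otimes>\<^bsub>H\<^esub> x \<otimes>\<^bsub>H\<^esub> (ts ! (j div n)) \<in> K
     then \<rho> (inv\<^bsub>H\<^esub> (ts ! (i div n)) \<otimes>\<^bsub>H\<^esub> x \<otimes>\<^bsub>H\<^esub> (ts ! (j div n))) $$ (i mod n, j mod n) else 0)"
  using assms by (simp add: ind_rep_def Let_def dim_rep_one)

text \<open>In the sum over the intermediate block index, only the coset \<open>q0\<close>
  containing y times the representative of block column \<open>r\<close> contributes. The arguments
  of \<rho> in the two remaining blocks multiply to the argument for the product.\<close>

lemma ind_rep_mult:
  assumes x: "x \<in> carrier H" and y: "y \<in> carrier H"
  shows "ind_rep H K ts \<rho> (x \<otimes>\<^bsub>H\<^esub> y) = ind_rep H K ts \<rho> x * ind_rep H K ts \<rho> y"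
proof (rule eq_matI)
  let ?D = "length ts * n"
  fix i j
  assume "i < dim_row (ind_rep H K ts \<rho> x * ind_rep H K ts \<rho> y)"
    and "j < dim_col (ind_rep H K ts \<rho> x * ind_rep H K ts \<rho> y)"
  then have i: "i < ?D" and j: "j < ?D"
    using ind_rep_carrier[of x] ind_rep_carrier[of y] by auto
  define p r a b where "p = i div n" and "r = j div n" and "a = i mod n" and "b = j mod n"
  have p: "p < length ts" and r: "r < length ts" and a: "a < n" and b: "b < n"
    using div_less_blocks[OF i] div_less_blocks[OF j] mod_less_blocks[OF i] mod_less_blocks[OF j]
    by (simp_all add: p_def r_def a_def b_def)
  note tp = transversal_closed[OF p] and tr = transversal_closed[OF r]
  define X where "X q = inv\<^bsub>H\<^esub> (ts ! p) \<otimes>\<^bsub>H\<^esub> x \<otimes>\<^bsub>H\<^esub> (ts ! q)" for q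
  define Y where "Y q = inv\<^bsub>H\<^esub> (ts ! q) \<otimes>\<^bsub>H\<^esub> y \<otimes>\<^bsub>H\<^esub> (ts ! r)" for q
  define Z where "Z = inv\<^bsub>H\<^esub> (ts ! p) \<otimes>\<^bsub>H\<^esub> (x \<otimes>\<^bsub>H\<^esub> y) \<otimes>\<^bsub>H\<^esub> (ts ! r)"
  have Y_alt: "Y q = inv\<^bsub>H\<^esub> (ts ! q) \<otimes>\<^bsub>H\<^esub> (y \<otimes>\<^bsub>H\<^esub> (ts ! r))" if "q < length ts" for q
    using transversal_closed[OF that] tr y by (simp add: Y_def m_assoc)
  obtain q0 where q0: "q0 < length ts" "Y q0 \<in> K"
    and uniq: "\<And>q. q < length ts \<Longrightarrow> Y q \<in> K \<Longrightarrow> q = q0"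
    using transversal_ex1[OF m_closed[OF y tr]] Y_alt by (metis (no_types, lifting))
  note tq0 = transversal_closed[OF q0(1)]
  have Z_eq: "Z = X q0 \<otimes>\<^bsub>H\<^esub> Y q0"
  proof -
    have "X q0 \<otimes>\<^bsub>H\<^esub> Y q0 = inv\<^bsub>H\<^esub> (ts ! p) \<otimes>\<^bsub>H\<^esub> x \<otimes>\<^bsub>H\<^esub> (ts ! q0 \<otimes>\<^bsub>H\<^esub> inv\<^bsub>H\<^esub> (ts ! q0)) \<otimes>\<^bsub>H\<^esub> (y \<otimes>\<^bsub>H\<^esub> (ts ! r))"
      using tp tq0 tr x y unfolding X_def Y_def by (simp only: m_assoc m_closed inv_closed)
    also have "\<dots> = Z" using tp tq0 tr x y by (simp add: Z_def m_assoc)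
    finally show ?thesis by simp
  qed
  have Xc: "X q0 \<in> carrier H" and Yc: "Y q0 \<in> carrier H"
    using tp tq0 tr x y by (simp_all add: X_def Y_def)
  \<comment> \<open>As \<open>Y q0\<close> lies in K, the blocks of the product and of the left
    factor vanish by default in the same cases.\<close>
  have ZK: "Z \<in> K \<longleftrightarrow> X q0 \<in> K"
  proof
    assume "Z \<in> K"
    then have "Z \<otimes>\<^bsub>H\<^esub> inv\<^bsub>H\<^esub> Y q0 \<in> K" using q0(2) K by (simp add: subgroup.m_closed subgroup.m_inv_closed)
    then show "X q0 \<in> K" using Xc Yc Z_eq by (simp add: m_assoc)
  qed (use q0(2) K Z_eq in \<open>simp add: subgroup.m_closed\<close>)
  have "(ind_rep H K ts \<rho> x * ind_rep H K ts \<rho> y) $$ (i, j) =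
      (\<Sum>q<length ts. \<Sum>c<n. ind_rep H K ts \<rho> x $$ (i, q * n + c) * ind_rep H K ts \<rho> y $$ (q * n + c, j))"
    by (rule mult_mat_index_blocks[OF ind_rep_carrier[of x] ind_rep_carrier[of y] i j])
  also have "\<dots> = (\<Sum>q<length ts. \<Sum>c<n. (if X q \<in> K then \<rho> (X q) $$ (a, c) else 0) *
      (if Y q \<in> K then \<rho> (Y q) $$ (c, b) else 0))"
    using i j by (intro sum.cong refl)
      (simp add: ind_rep_index block_index_less X_def Y_def p_def r_def a_def b_def)
  also have "\<dots> = (\<Sum>q<length ts. if q = q0 then
      (\<Sum>c<n. (if X q0 \<in> K then \<rho> (X q0) $$ (a, c) else 0) * \<rho> (Y q0) $$ (c, b)) else 0)"
  proof (intro sum.cong refl)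
    fix q assume "q \<in> {..<length ts}"
    then have "Y q \<in> K \<longleftrightarrow> q = q0" using q0(2) uniq by blast
    then show "(\<Sum>c<n. (if X q \<in> K then \<rho> (X q) $$ (a, c) else 0) * (if Y q \<in> K then \<rho> (Y q) $$ (c, b) else 0)) =
      (if q = q0 then (\<Sum>c<n. (if X q0 \<in> K then \<rho> (X q0) $$ (a, c) else 0) * \<rho> (Y q0) $$ (c, b)) else 0)"
      by (cases "q = q0") auto
  qed
  also have "\<dots> = (\<Sum>c<n. (if X q0 \<in> K then \<rho> (X q0) $$ (a, c) else 0) * \<rho> (Y q0) $$ (c, b))"
    using q0(1) by simp
  also have "\<dots> = (if Z \<in> K then \<rho> Z $$ (a, b) else 0)"
  proof (cases "X q0 \<in> K")
    case True
    have "\<rho> Z = \<rho> (X q0) * \<rho> (Y q0)"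
      using rep_mult[OF group_K \<rho>, of "X q0" "Y q0"] True q0(2) Z_eq by simp
    then show ?thesis
      using True ZK a b rep_carrier_mat[OF group_K \<rho>, of "X q0"] rep_carrier_mat[OF group_K \<rho>, of "Y q0"] q0(2)
      by (simp add: scalar_prod_def lessThan_atLeast0)
  qed (simp add: ZK)
  also have "\<dots> = ind_rep H K ts \<rho> (x \<otimes>\<^bsub>H\<^esub> y) $$ (i, j)"
    using i j by (simp add: ind_rep_index Z_def p_def r_def a_def b_def)
  finally show "ind_rep H K ts \<rho> (x \<otimes>\<^bsub>H\<^esub> y) $$ (i, j) = (ind_rep H K ts \<rho> x * ind_rep H K ts \<rho> y) $$ (i, j)"
    by (rule sym)
qed (use ind_rep_carrier[of x] ind_rep_carrier[of y] ind_rep_carrier[of "x \<otimes>\<^bsub>H\<^esub> y"] in auto)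

lemma ind_rep_one: "ind_rep H K ts \<rho> \<one>\<^bsub>H\<^esub> = 1\<^sub>m (length ts * n)"
proof (rule eq_matI)
  let ?D = "length ts * n"
  fix i j
  assume "i < dim_row (1\<^sub>m ?D :: complex mat)" "j < dim_col (1\<^sub>m ?D :: complex mat)"
  then have i: "i < ?D" and j: "j < ?D" by auto
  note p = div_less_blocks[OF i] and r = div_less_blocks[OF j]
  have "i = j \<longleftrightarrow> i div n = j div n \<and> i mod n = j mod n"
    by (metis div_mult_mod_eq)
  then show "ind_rep H K ts \<rho> \<one>\<^bsub>H\<^esub> $$ (i, j) = 1\<^sub>m ?D $$ (i, j)"
    using i j transversal_closed[OF p] transversal_closed[OF r] transversal_eq[OF p r]
      mod_less_blocks[OF i] mod_less_blocks[OF j] rep_one[OF group_K \<rho>]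
    by (auto simp: ind_rep_index)
qed (use ind_rep_carrier[of "\<one>\<^bsub>H\<^esub>"] in auto)

text \<open>Exchanging the two block indices inverts the argument of \<rho>, so adjoints are taken
  blockwise. Unitarity in \<open>ind_rep_hom\<close> then follows from multiplicativity.\<close>

lemma ind_rep_inv:
  assumes x: "x \<in> carrier H"
  shows "ind_rep H K ts \<rho> (inv\<^bsub>H\<^esub> x) = mat_adjoint (ind_rep H K ts \<rho> x)"
proof (rule eq_matI)
  let ?D = "length ts * n"
  fix i j
  assume "i < dim_row (mat_adjoint (ind_rep H K ts \<rho> x))" "j < dim_col (mat_adjoint (ind_rep H K ts \<rho> x))"
  then have i: "i < ?D" and j: "j < ?D"
    using mat_adjoint_carrier[OF ind_rep_carrier[of x]] by auto
  note tp = transversal_closed[OF div_less_blocks[OF i]] and tr = transversal_closed[OF div_less_blocks[OF j]]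
  let ?X = "inv\<^bsub>H\<^esub> (ts ! (j div n)) \<otimes>\<^bsub>H\<^esub> x \<otimes>\<^bsub>H\<^esub> (ts ! (i div n))"
  have X: "?X \<in> carrier H" using tp tr x by simp
  have eq: "inv\<^bsub>H\<^esub> (ts ! (i div n)) \<otimes>\<^bsub>H\<^esub> inv\<^bsub>H\<^esub> x \<otimes>\<^bsub>H\<^esub> (ts ! (j div n)) = inv\<^bsub>H\<^esub> ?X"
    using tp tr x by (simp add: inv_mult_group m_assoc)
  have K_iff: "inv\<^bsub>H\<^esub> ?X \<in> K \<longleftrightarrow> ?X \<in> K"
    using subgroup.m_inv_closed[OF K] X inv_inv by metis
  have "\<rho> (inv\<^bsub>H\<^esub> ?X) = mat_adjoint (\<rho> ?X)" if "?X \<in> K"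
    using rep_inv[OF group_K \<rho>, of ?X] that m_inv_consistent[OF K] by simp
  moreover have "mat_adjoint (ind_rep H K ts \<rho> x) $$ (i, j) = cnj (ind_rep H K ts \<rho> x $$ (j, i))"
    using i j ind_rep_carrier[of x] by (intro mat_adjoint_index) auto
  moreover have "mat_adjoint (\<rho> ?X) $$ (i mod n, j mod n) = cnj (\<rho> ?X $$ (j mod n, i mod n))" if "?X \<in> K"
    using mod_less_blocks[OF i] mod_less_blocks[OF j] rep_carrier_mat[OF group_K \<rho>, of ?X] that
    by (intro mat_adjoint_index) auto
  ultimately show "ind_rep H K ts \<rho> (inv\<^bsub>H\<^esub> x) $$ (i, j) = mat_adjoint (ind_rep H K ts \<rho> x) $$ (i, j)"
    using i j by (simp add: ind_rep_index eq K_iff)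
qed (use ind_rep_carrier[of "inv\<^bsub>H\<^esub> x"] mat_adjoint_carrier[OF ind_rep_carrier[of x]] in auto)

lemma ind_rep_hom: "ind_rep H K ts \<rho> \<in> hom H (unitary_grp (length ts * n))"
proof (rule homI)
  fix x assume x: "x \<in> carrier H"
  have "ind_rep H K ts \<rho> x * mat_adjoint (ind_rep H K ts \<rho> x) = 1\<^sub>m (length ts * n)"
    using ind_rep_mult[OF x inv_closed[OF x]] by (simp add: ind_rep_inv x ind_rep_one)
  then show "ind_rep H K ts \<rho> x \<in> carrier (unitary_grp (length ts * n))"
    using ind_rep_carrier[of x] by (simp add: unitary_grp_def)
qed (simp add: ind_rep_mult)

end
end

lemma dual_memD:
  assumes "group H" "c \<in> dual H" "\<rho> \<in> c"
  shows "irreducible_rep H \<rho>" "c = rep_equiv H `` {\<rho>}"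
proof -
  from assms(2) obtain \<sigma> where \<sigma>: "irreducible_rep H \<sigma>" "c = rep_equiv H `` {\<sigma>}" by (rule dual_cases)
  with assms(3) have "(\<sigma>, \<rho>) \<in> rep_equiv H" by blast
  then show "irreducible_rep H \<rho>" "c = rep_equiv H `` {\<rho>}"
    using irreducible_rep_equiv[OF assms(1) \<sigma>(1)] equiv_class_eq[OF equiv_rep_equiv[OF assms(1)]] \<sigma>(2)
    by blast+
qed

lemma dual_nonempty:
  assumes "group H" "c \<in> dual H"
  obtains \<rho> where "\<rho> \<in> c"
proof -
  from assms(2) obtain \<sigma> where \<sigma>: "irreducible_rep H \<sigma>" "c = rep_equiv H `` {\<sigma>}" by (rule dual_cases)
  have "\<sigma> \<in> c"
    using equiv_class_self[OF equiv_rep_equiv[OF assms(1)] irreducible_rep_in_reps[OF \<sigma>(1)]] \<sigma>(2) by simp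
  then show ?thesis by (rule that)
qed

text \<open>Shared by conjugation and twisting: identities between classes can be checked on any one
  representative.\<close>

lemma on_classes_dual:
  assumes H: "group H" and c: "c \<in> dual H" and \<rho>: "\<rho> \<in> c"
    and irr: "\<And>\<sigma>. irreducible_rep H \<sigma> \<Longrightarrow> irreducible_rep H (f \<sigma>)"
    and resp: "\<And>\<sigma> \<tau>. (\<sigma>, \<tau>) \<in> rep_equiv H \<Longrightarrow> (f \<sigma>, f \<tau>) \<in> rep_equiv H"
  shows "on_classes H f c = rep_equiv H `` {f \<rho>}" "on_classes H f c \<in> dual H" "f \<rho> \<in> on_classes H f c"
proof -
  note D = dual_memD[OF H c \<rho>]
  show eq: "on_classes H f c = rep_equiv H `` {f \<rho>}"
    unfolding D(2) by (rule on_classes_class[OF H H irreducible_rep_in_reps[OF D(1)] resp])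
  show "on_classes H f c \<in> dual H" unfolding eq by (rule dualI[OF irr[OF D(1)]])
  show "f \<rho> \<in> on_classes H f c"
    unfolding eq by (rule equiv_class_self[OF equiv_rep_equiv[OF H] irreducible_rep_in_reps[OF irr[OF D(1)]]])
qed

text \<open>Unlike \<open>conj_rep\<close>, which computes in the Euclidean group, this allows any
  ambient group, so that induction from a normal subgroup can be treated abstractly.
  \<open>cj_eq\<close> reconciles the two on classes.\<close>

definition conjugate_rep :: "('a, 'm) monoid_scheme \<Rightarrow> 'a \<Rightarrow> ('a \<Rightarrow> complex mat) \<Rightarrow> 'a \<Rightarrow> complex mat" where
  "conjugate_rep G g \<rho> = (\<lambda>x. \<rho> (inv\<^bsub>G\<^esub> g \<otimes>\<^bsub>G\<^esub> x \<otimes>\<^bsub>G\<^esub> g))"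

section \<open>Induction from a normal subgroup\<close>

context normal
begin

abbreviation conjugate_class :: "'a \<Rightarrow> 'a rep_class \<Rightarrow> 'a rep_class" where
  "conjugate_class g \<equiv> on_classes (G\<lparr>carrier := H\<rparr>) (conjugate_rep G g)"

lemma group_H: "group (G\<lparr>carrier := H\<rparr>)"
  by (rule subgroup_is_group[OF is_group])

lemmas equiv_H = equiv_rep_equiv[OF group_H]

lemma conj_mem_iff:
  assumes "g \<in> carrier G" "x \<in> carrier G"
  shows "inv g \<otimes> x \<otimes> g \<in> H \<longleftrightarrow> x \<in> H"
proof
  assume "inv g \<otimes> x \<otimes> g \<in> H"
  then have "g \<otimes> (inv g \<otimes> x \<otimes> g) \<otimes> inv g \<in> H" by (rule inv_op_closed2[OF assms(1)])
  moreover have "g \<otimes> (inv g \<otimes> x \<otimes> g) \<otimes> inv g = (g \<otimes> inv g) \<otimes> x \<otimes> (g \<otimes> inv g)"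
    using assms by (simp only: m_assoc m_closed inv_closed)
  ultimately show "x \<in> H" using assms by simp
qed (rule inv_op_closed1[OF assms(1)])

section \<open>Conjugates of representations of the normal subgroup\<close>

lemma conjugate_rep_hom:
  assumes g: "g \<in> carrier G" and \<rho>: "\<rho> \<in> hom (G\<lparr>carrier := H\<rparr>) (unitary_grp n)"
  shows "conjugate_rep G g \<rho> \<in> hom (G\<lparr>carrier := H\<rparr>) (unitary_grp n)"
proof (rule homI)
  fix x assume "x \<in> carrier (G\<lparr>carrier := H\<rparr>)"
  then show "conjugate_rep G g \<rho> x \<in> carrier (unitary_grp n)"
    using rep_closed[OF group_H \<rho>] inv_op_closed1[OF g] by (simp add: conjugate_rep_def)
next
  fix x y assume "x \<in> carrier (G\<lparr>carrier := H\<rparr>)" "y \<in> carrier (G\<lparr>carrier := H\<rparr>)"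
  then have xy: "x \<in> H" "y \<in> H" by auto
  have "inv g \<otimes> x \<otimes> g \<otimes> (inv g \<otimes> y \<otimes> g) = inv g \<otimes> x \<otimes> (g \<otimes> inv g) \<otimes> (y \<otimes> g)"
    using xy g subset by (simp only: m_assoc m_closed inv_closed subset_iff)
  also have "\<dots> = inv g \<otimes> (x \<otimes> y) \<otimes> g"
    using xy g by (simp add: m_assoc)
  finally show "conjugate_rep G g \<rho> (x \<otimes>\<^bsub>G\<lparr>carrier := H\<rparr>\<^esub> y) =
      conjugate_rep G g \<rho> x \<otimes>\<^bsub>unitary_grp n\<^esub> conjugate_rep G g \<rho> y"
    using rep_mult[OF group_H \<rho>, of "inv g \<otimes> x \<otimes> g" "inv g \<otimes> y \<otimes> g"] inv_op_closed1[OF g] xy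
    by (simp add: conjugate_rep_def)
qed

lemma conjugate_rep_reps:
  "g \<in> carrier G \<Longrightarrow> \<rho> \<in> reps (G\<lparr>carrier := H\<rparr>) \<Longrightarrow> conjugate_rep G g \<rho> \<in> reps (G\<lparr>carrier := H\<rparr>)"
  using conjugate_rep_hom by (auto simp: reps_def)

lemma conjugate_rep_mult:
  assumes "g \<in> carrier G" "h \<in> carrier G" "x \<in> H"
  shows "conjugate_rep G g (conjugate_rep G h \<rho>) x = conjugate_rep G (g \<otimes> h) \<rho> x"
  using assms by (simp add: conjugate_rep_def inv_mult_group m_assoc)

lemma conjugate_rep_one: "x \<in> H \<Longrightarrow> conjugate_rep G \<one> \<rho> x = \<rho> x"
  by (simp add: conjugate_rep_def)

lemma conjugate_rep_equiv:
  assumes g: "g \<in> carrier G" and eq: "(\<rho>, \<sigma>) \<in> rep_equiv (G\<lparr>carrier := H\<rparr>)"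
  shows "(conjugate_rep G g \<rho>, conjugate_rep G g \<sigma>) \<in> rep_equiv (G\<lparr>carrier := H\<rparr>)"
proof -
  from eq obtain n U where *: "\<rho> \<in> hom (G\<lparr>carrier := H\<rparr>) (unitary_grp n)"
    "\<sigma> \<in> hom (G\<lparr>carrier := H\<rparr>) (unitary_grp n)" "U \<in> carrier (unitary_grp n)"
    "\<And>h. h \<in> H \<Longrightarrow> \<sigma> h = U * \<rho> h * mat_adjoint U"
    by (auto simp: rep_equiv_def)
  show ?thesis
    by (rule rep_equivI[OF conjugate_rep_hom[OF g *(1)] conjugate_rep_hom[OF g *(2)] *(3)])
      (use *(4) inv_op_closed1[OF g] in \<open>simp add: conjugate_rep_def\<close>)
qed

lemma irreducible_conjugate_rep:
  assumes g: "g \<in> carrier G" and irr: "irreducible_rep (G\<lparr>carrier := H\<rparr>) \<rho>"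
  shows "irreducible_rep (G\<lparr>carrier := H\<rparr>) (conjugate_rep G g \<rho>)"
proof -
  obtain n where \<rho>: "\<rho> \<in> hom (G\<lparr>carrier := H\<rparr>) (unitary_grp n)"
    using irr by (auto simp: irreducible_rep_def)
  show ?thesis
  proof (rule irreducible_rep_transfer[OF group_H irr \<rho> conjugate_rep_hom[OF g \<rho>]])
    fix h assume "h \<in> carrier (G\<lparr>carrier := H\<rparr>)"
    then have h: "h \<in> H" by simp
    \<comment> \<open>The conjugated representation takes the value of \<rho> at h on this element,
      so \<open>irreducible_rep_transfer\<close> applies with scalar 1.\<close>
    have "g \<otimes> h \<otimes> inv g \<in> H" by (rule inv_op_closed2[OF g h])
    moreover have "inv g \<otimes> (g \<otimes> h \<otimes> inv g) \<otimes> g = (inv g \<otimes> g) \<otimes> h \<otimes> (inv g \<otimes> g)"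
      using g mem_carrier[OF h] by (simp only: m_assoc m_closed inv_closed)
    then have "\<rho> h = 1 \<cdot>\<^sub>m conjugate_rep G g \<rho> (g \<otimes> h \<otimes> inv g)"
      using g h by (simp add: conjugate_rep_def one_smult_mat)
    ultimately show "\<exists>h'\<in>carrier (G\<lparr>carrier := H\<rparr>). \<exists>c. \<rho> h = c \<cdot>\<^sub>m conjugate_rep G g \<rho> h'"
      by auto
  qed
qed

lemma conjugate_class_dual:
  assumes "g \<in> carrier G" "c \<in> dual (G\<lparr>carrier := H\<rparr>)"
  shows "conjugate_class g c \<in> dual (G\<lparr>carrier := H\<rparr>)"
    and "\<rho> \<in> c \<Longrightarrow> conjugate_class g c = rep_equiv (G\<lparr>carrier := H\<rparr>) `` {conjugate_rep G g \<rho>}"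
    and "\<rho> \<in> c \<Longrightarrow> conjugate_rep G g \<rho> \<in> conjugate_class g c"
proof -
  note * = on_classes_dual[OF group_H assms(2) _ irreducible_conjugate_rep[OF assms(1)] conjugate_rep_equiv[OF assms(1)]]
  obtain \<sigma> where "\<sigma> \<in> c" using dual_nonempty[OF group_H assms(2)] .
  then show "conjugate_class g c \<in> dual (G\<lparr>carrier := H\<rparr>)" by (rule *(2))
  show "\<rho> \<in> c \<Longrightarrow> conjugate_class g c = rep_equiv (G\<lparr>carrier := H\<rparr>) `` {conjugate_rep G g \<rho>}" by (rule *(1))
  show "\<rho> \<in> c \<Longrightarrow> conjugate_rep G g \<rho> \<in> conjugate_class g c" by (rule *(3))
qed

lemmas conjugate_class_eq = conjugate_class_dual(2)
  and conjugate_rep_in_class = conjugate_class_dual(3)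

lemma conjugate_class_mult:
  assumes g: "g \<in> carrier G" and h: "h \<in> carrier G" and c: "c \<in> dual (G\<lparr>carrier := H\<rparr>)"
  shows "conjugate_class g (conjugate_class h c) = conjugate_class (g \<otimes> h) c"
proof -
  obtain \<rho> where \<rho>: "\<rho> \<in> c" using dual_nonempty[OF group_H c] .
  have "\<rho> \<in> reps (G\<lparr>carrier := H\<rparr>)" using irreducible_rep_in_reps dual_memD(1)[OF group_H c \<rho>] .
  then have "(conjugate_rep G (g \<otimes> h) \<rho>, conjugate_rep G g (conjugate_rep G h \<rho>)) \<in> rep_equiv (G\<lparr>carrier := H\<rparr>)"
    using g h by (intro rep_equiv_of_eq[OF group_H] conjugate_rep_reps) (simp_all add: conjugate_rep_mult)
  then show ?thesis
    using conjugate_class_eq[OF g conjugate_class_dual(1)[OF h c] conjugate_rep_in_class[OF h c \<rho>]]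
      conjugate_class_eq[OF m_closed[OF g h] c \<rho>] equiv_class_eq[OF equiv_H] by simp
qed

lemma conjugate_class_one:
  assumes c: "c \<in> dual (G\<lparr>carrier := H\<rparr>)"
  shows "conjugate_class \<one> c = c"
proof -
  obtain \<rho> where \<rho>: "\<rho> \<in> c" using dual_nonempty[OF group_H c] .
  have "\<rho> \<in> reps (G\<lparr>carrier := H\<rparr>)" using irreducible_rep_in_reps dual_memD(1)[OF group_H c \<rho>] .
  then have "(\<rho>, conjugate_rep G \<one> \<rho>) \<in> rep_equiv (G\<lparr>carrier := H\<rparr>)"
    by (intro rep_equiv_of_eq[OF group_H]) (simp_all add: conjugate_rep_one)
  then show ?thesis
    using conjugate_class_eq[OF one_closed c \<rho>] dual_memD(2)[OF group_H c \<rho>] equiv_class_eq[OF equiv_H]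
    by simp
qed

text \<open>By normality the coset of t g is the coset of t translated on the right by g, and right
  translation by g permutes the group.\<close>

lemma left_transversal_shift:
  assumes ts: "left_transversal G H ts" and g: "g \<in> carrier G"
  shows "left_transversal G H (map (\<lambda>t. t \<otimes> g) ts)"
  unfolding left_transversal_def
proof (intro conjI ballI)
  show "set (map (\<lambda>t. t \<otimes> g) ts) \<subseteq> carrier G"
    using ts g by (auto simp: left_transversal_def)
  fix x assume x: "x \<in> carrier G"
  have "x \<in> (map (\<lambda>t. t \<otimes> g) ts ! p) <# H \<longleftrightarrow> inv (ts ! p) \<otimes> (x \<otimes> inv g) \<in> H" if p: "p < length ts" for p
  proof -
    have t: "ts ! p \<in> carrier G" using transversal_closed[OF is_group is_subgroup ts p] .
    have "inv (ts ! p \<otimes> g) \<otimes> x = inv g \<otimes> (inv (ts ! p) \<otimes> (x \<otimes> inv g)) \<otimes> g"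
      using t g x by (simp add: inv_mult_group m_assoc)
    then show ?thesis
      using p t g x in_l_coset_iff[OF is_subgroup, of "ts ! p \<otimes> g" x] conj_mem_iff[OF g, of "inv (ts ! p) \<otimes> (x \<otimes> inv g)"]
      by simp
  qed
  then show "\<exists>!i. i < length (map (\<lambda>t. t \<otimes> g) ts) \<and> x \<in> (map (\<lambda>t. t \<otimes> g) ts ! i) <# H"
    using transversal_ex1[OF is_group is_subgroup ts, of "x \<otimes> inv g"] x g by (simp cong: conj_cong)
qed

text \<open>Conjugating the argument by g amounts to replacing every representative t by t g. The
  matrices coincide entry by entry, so no intertwiner has to be constructed.\<close>

lemma ind_rep_conjugate:
  assumes ts: "left_transversal G H ts" and g: "g \<in> carrier G" and x: "x \<in> carrier G"
  shows "ind_rep G H ts (conjugate_rep G g \<rho>) x = ind_rep G H (map (\<lambda>t. t \<otimes> g) ts) \<rho> x"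
proof -
  define n where "n = dim_row (\<rho> \<one>)"
  have n': "dim_row (conjugate_rep G g \<rho> \<one>) = n" using g by (simp add: conjugate_rep_def n_def)
  show ?thesis
  proof (rule eq_matI)
    fix i j
    assume "i < dim_row (ind_rep G H (map (\<lambda>t. t \<otimes> g) ts) \<rho> x)"
      and "j < dim_col (ind_rep G H (map (\<lambda>t. t \<otimes> g) ts) \<rho> x)"
    then have i: "i < length ts * n" and j: "j < length ts * n"
      by (auto simp: ind_rep_def Let_def n_def)
    note p = div_less_blocks[OF i] and q = div_less_blocks[OF j]
    note tp = transversal_closed[OF is_group is_subgroup ts p]
      and tq = transversal_closed[OF is_group is_subgroup ts q]
    let ?x = "inv (ts ! (i div n)) \<otimes> x \<otimes> (ts ! (j div n))"
    have "inv (ts ! (i div n) \<otimes> g) \<otimes> x \<otimes> (ts ! (j div n) \<otimes> g) = inv g \<otimes> ?x \<otimes> g"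
      using tp tq g x by (simp add: inv_mult_group m_assoc)
    moreover have "inv g \<otimes> ?x \<otimes> g \<in> H \<longleftrightarrow> ?x \<in> H"
      using tp tq x by (intro conj_mem_iff[OF g]) simp
    ultimately show "ind_rep G H ts (conjugate_rep G g \<rho>) x $$ (i, j) =
        ind_rep G H (map (\<lambda>t. t \<otimes> g) ts) \<rho> x $$ (i, j)"
      using i j p q by (simp add: ind_rep_def Let_def n' flip: n_def) (simp add: conjugate_rep_def)
  qed (simp_all add: ind_rep_def Let_def n' flip: n_def)
qed

lemma mem_Ind_iff:
  "\<tau> \<in> Ind G H c \<longleftrightarrow> (\<exists>ts \<rho>. left_transversal G H ts \<and> \<rho> \<in> c \<and> (ind_rep G H ts \<rho>, \<tau>) \<in> rep_equiv G)"
  by (auto simp: Ind_def on_classes_def)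

text \<open>Moving the representatives by \<open>inv g\<close> compensates the conjugation by g. The
  reverse inclusion comes from applying this to \<open>inv g\<close> and the conjugated
  class.\<close>

lemma Ind_subset_conjugate:
  assumes g: "g \<in> carrier G" and c: "c \<in> dual (G\<lparr>carrier := H\<rparr>)"
  shows "Ind G H c \<subseteq> Ind G H (conjugate_class g c)"
proof
  fix \<tau> assume "\<tau> \<in> Ind G H c"
  then obtain ts \<rho> where ts: "left_transversal G H ts" and \<rho>: "\<rho> \<in> c"
    and \<tau>: "(ind_rep G H ts \<rho>, \<tau>) \<in> rep_equiv G"
    by (auto simp: mem_Ind_iff)
  obtain n where n: "\<rho> \<in> hom (G\<lparr>carrier := H\<rparr>) (unitary_grp n)"
    using dual_memD(1)[OF group_H c \<rho>] by (auto simp: irreducible_rep_def)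
  define ts' where "ts' = map (\<lambda>t. t \<otimes> inv g) ts"
  have ts': "left_transversal G H ts'"
    unfolding ts'_def using left_transversal_shift[OF ts inv_closed[OF g]] .
  have "map (\<lambda>t. t \<otimes> g) ts' = ts"
    using ts g by (auto simp: ts'_def left_transversal_def m_assoc intro!: map_idI)
  then have "ind_rep G H ts \<rho> x = ind_rep G H ts' (conjugate_rep G g \<rho>) x" if "x \<in> carrier G" for x
    using ind_rep_conjugate[OF ts' g that, of \<rho>] by simp
  moreover have "ind_rep G H ts' (conjugate_rep G g \<rho>) \<in> reps G"
    using ind_rep_hom[OF is_group is_subgroup ts' conjugate_rep_hom[OF g n]] by (auto simp: reps_def)
  ultimately have "(ind_rep G H ts' (conjugate_rep G g \<rho>), ind_rep G H ts \<rho>) \<in> rep_equiv G"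
    by (intro rep_equiv_of_eq[OF is_group]) simp_all
  then have "(ind_rep G H ts' (conjugate_rep G g \<rho>), \<tau>) \<in> rep_equiv G"
    using \<tau> equiv_rep_equiv[OF is_group] by (meson equivE transD)
  then show "\<tau> \<in> Ind G H (conjugate_class g c)"
    using ts' conjugate_rep_in_class[OF g c \<rho>] by (auto simp: mem_Ind_iff)
qed

lemma Ind_conjugate_class:
  assumes g: "g \<in> carrier G" and c: "c \<in> dual (G\<lparr>carrier := H\<rparr>)"
  shows "Ind G H (conjugate_class g c) = Ind G H c"
proof
  have "conjugate_class (inv g) (conjugate_class g c) = c"
    using g c by (simp add: conjugate_class_mult conjugate_class_one)
  then show "Ind G H (conjugate_class g c) \<subseteq> Ind G H c"
    using Ind_subset_conjugate[OF inv_closed[OF g] conjugate_class_dual(1)[OF g c]] by simp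
qed (rule Ind_subset_conjugate[OF g c])

text \<open>
  Restricted to the normal subgroup, both induced representations are block diagonal with conjugates
  on the diagonal, so that every block of a unitary intertwiner is an intertwiner of conjugates.
\<close>
lemma ind_rep_equivD:
  assumes ts: "left_transversal G H ts" and ts': "left_transversal G H ts'"
    and irr: "irreducible_rep (G\<lparr>carrier := H\<rparr>) \<rho>" "irreducible_rep (G\<lparr>carrier := H\<rparr>) \<sigma>"
    and eq: "(ind_rep G H ts \<rho>, ind_rep G H ts' \<sigma>) \<in> rep_equiv G"
  obtains s t where "s \<in> carrier G" "t \<in> carrier G"
    "(conjugate_rep G s \<rho>, conjugate_rep G t \<sigma>) \<in> rep_equiv (G\<lparr>carrier := H\<rparr>)"
proof -
  obtain n where \<rho>: "\<rho> \<in> hom (G\<lparr>carrier := H\<rparr>) (unitary_grp n)"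
    using irr(1) by (auto simp: irreducible_rep_def)
  obtain m where \<sigma>: "\<sigma> \<in> hom (G\<lparr>carrier := H\<rparr>) (unitary_grp m)"
    using irr(2) by (auto simp: irreducible_rep_def)
  let ?R = "ind_rep G H ts \<rho>" and ?S = "ind_rep G H ts' \<sigma>"
  note tr = is_group is_subgroup ts and tr' = is_group is_subgroup ts'
  from eq obtain D U where D: "?R \<in> hom G (unitary_grp D)" "?S \<in> hom G (unitary_grp D)"
    and U: "U \<in> carrier (unitary_grp D)"
    and RS: "\<And>h. h \<in> carrier G \<Longrightarrow> ?S h = U * ?R h * mat_adjoint U"
    by (auto simp: rep_equiv_def)
  have Dn: "D = length ts * n" using rep_dim_unique[OF is_group D(1) ind_rep_hom[OF tr \<rho>]] .
  have Dm: "D = length ts' * m" using rep_dim_unique[OF is_group D(2) ind_rep_hom[OF tr' \<sigma>]] .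
  note Uc = unitary_carrier_mat[OF U] and Ua = mat_adjoint_carrier[OF unitary_carrier_mat[OF U]]
  have inter: "?S h * U = U * ?R h" if h: "h \<in> carrier G" for h
  proof -
    note Rc = rep_carrier_mat[OF is_group D(1) h]
    have "?S h * U = U * ?R h * (mat_adjoint U * U)"
      unfolding RS[OF h] by (rule assoc_mult_mat[OF mult_carrier_mat[OF Uc Rc] Ua Uc])
    then show ?thesis using right_mult_one_mat[OF mult_carrier_mat[OF Uc Rc]] by (simp add: unitary_left[OF U])
  qed
  have "D > 0" using transversal_nonempty[OF tr] irreducible_repD(1)[OF irr(1) group_H \<rho>] by (simp add: Dn)
  \<comment> \<open>A unitary matrix of positive size is nonzero, which supplies the nonzero entry
    that Schur's lemma asks for.\<close>
  have "\<exists>i<D. \<exists>j<D. U $$ (i, j) \<noteq> 0"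
  proof (rule ccontr)
    assume "\<not> ?thesis"
    then have "U = 0\<^sub>m D D" using Uc by (intro eq_matI) auto
    then have "1\<^sub>m D = (0\<^sub>m D D :: complex mat)" using unitary_right[OF U] Ua by simp
    then have "(1\<^sub>m D :: complex mat) $$ (0, 0) = 0\<^sub>m D D $$ (0, 0)" by simp
    with \<open>D > 0\<close> show False by simp
  qed
  then obtain i j where i: "i < D" and j: "j < D" and nz: "U $$ (i, j) \<noteq> 0" by blast
  \<comment> \<open>The block of U containing the nonzero entry. It has size m by n, because the
    dimensions of \<rho> and \<sigma> are not yet known to agree.\<close>
  define p where "p = i div m"
  define q where "q = j div n"
  have p: "p < length ts'" and im: "i mod m < m"
    using i div_less_blocks[of i] mod_less_blocks[of i] unfolding Dm p_def by auto
  have q: "q < length ts" and jn: "j mod n < n"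
    using j div_less_blocks[of j] mod_less_blocks[of j] unfolding Dn q_def by auto
  note tp = transversal_closed[OF tr' p] and tq = transversal_closed[OF tr q]
  define M where "M = mat m n (\<lambda>(a, b). U $$ (p * m + a, q * n + b))"
  have M: "M \<in> carrier_mat m n" by (simp add: M_def)
  have \<rho>': "conjugate_rep G (ts ! q) \<rho> \<in> hom (G\<lparr>carrier := H\<rparr>) (unitary_grp n)"
    and \<sigma>': "conjugate_rep G (ts' ! p) \<sigma> \<in> hom (G\<lparr>carrier := H\<rparr>) (unitary_grp m)"
    using conjugate_rep_hom tp tq \<rho> \<sigma> by auto
  have "(conjugate_rep G (ts ! q) \<rho>, conjugate_rep G (ts' ! p) \<sigma>) \<in> rep_equiv (G\<lparr>carrier := H\<rparr>)"
  proof (rule schur_unitary_equiv[OF group_H _ _ \<rho>' \<sigma>' M im jn])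
    show "irreducible_rep (G\<lparr>carrier := H\<rparr>) (conjugate_rep G (ts ! q) \<rho>)"
      "irreducible_rep (G\<lparr>carrier := H\<rparr>) (conjugate_rep G (ts' ! p) \<sigma>)"
      using irreducible_conjugate_rep tp tq irr by auto
    show "M $$ (i mod m, j mod n) \<noteq> 0" using nz im jn by (simp add: M_def p_def q_def)
    fix h assume "h \<in> carrier (G\<lparr>carrier := H\<rparr>)"
    then have h: "h \<in> H" and hG: "h \<in> carrier G" using subset by auto
    \<comment> \<open>By normality, \<open>inv s \<otimes> h \<otimes> t\<close> and
      \<open>inv s \<otimes> t\<close> differ by an element of H on the left: an element of H fixes
      every left coset.\<close>
    have mem: "inv s \<otimes> h \<otimes> t \<in> H \<longleftrightarrow> inv s \<otimes> t \<in> H" if "s \<in> carrier G" "t \<in> carrier G" for s t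
    proof -
      have eq: "inv s \<otimes> h \<otimes> t = (inv s \<otimes> h \<otimes> s) \<otimes> (inv s \<otimes> t)"
      proof -
        have "(inv s \<otimes> h \<otimes> s) \<otimes> (inv s \<otimes> t) = inv s \<otimes> h \<otimes> (s \<otimes> inv s) \<otimes> t"
          using that hG by (simp only: m_assoc m_closed inv_closed)
        then show ?thesis using that hG by simp
      qed
      have *: "inv s \<otimes> h \<otimes> s \<in> H" by (rule inv_op_closed1[OF that(1) h])
      show ?thesis
      proof
        assume "inv s \<otimes> h \<otimes> t \<in> H"
        then have "inv (inv s \<otimes> h \<otimes> s) \<otimes> (inv s \<otimes> h \<otimes> t) \<in> H" using * by simp
        then show "inv s \<otimes> t \<in> H" unfolding eq using that mem_carrier[OF *]
          by (simp add: m_assoc[symmetric])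
      qed (use * eq in simp)
    qed
    have blockS: "?S h $$ (p * m + a, p' * m + a') = (if p' = p then conjugate_rep G (ts' ! p) \<sigma> h $$ (a, a') else 0)"
      if "a < m" "p' < length ts'" "a' < m" for a p' a'
      using that p mem[OF tp transversal_closed[OF tr' that(2)]] transversal_eq[OF tr' p that(2)]
      by (auto simp: ind_rep_index[OF tr' \<sigma>] block_index_less conjugate_rep_def)
    have blockR: "?R h $$ (q' * n + b', q * n + b) = (if q' = q then conjugate_rep G (ts ! q) \<rho> h $$ (b', b) else 0)"
      if "b < n" "q' < length ts" "b' < n" for b q' b'
      using that q mem[OF transversal_closed[OF tr that(2)] tq] transversal_eq[OF tr that(2) q]
      by (auto simp: ind_rep_index[OF tr \<rho>] block_index_less conjugate_rep_def)
    note \<sigma>h = rep_carrier_mat[OF group_H \<sigma>', simplified, OF h]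
    note \<rho>h = rep_carrier_mat[OF group_H \<rho>', simplified, OF h]
    show "conjugate_rep G (ts' ! p) \<sigma> h * M = M * conjugate_rep G (ts ! q) \<rho> h"
    proof (rule eq_matI)
      fix a b assume "a < dim_row (M * conjugate_rep G (ts ! q) \<rho> h)" "b < dim_col (M * conjugate_rep G (ts ! q) \<rho> h)"
      then have a: "a < m" and b: "b < n" using M \<rho>h by auto
      have pa: "p * m + a < D" unfolding Dm by (rule block_index_less[OF p a])
      have qb: "q * n + b < D" unfolding Dn by (rule block_index_less[OF q b])
      have "(conjugate_rep G (ts' ! p) \<sigma> h * M) $$ (a, b) =
          (\<Sum>a'<m. conjugate_rep G (ts' ! p) \<sigma> h $$ (a, a') * U $$ (p * m + a', q * n + b))"
        using \<sigma>h a b by (simp add: scalar_prod_def lessThan_atLeast0 M_def)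
      \<comment> \<open>The product of blocks is padded with the vanishing off-diagonal blocks. It
        thereby becomes an entry of the full product, where the intertwining relation for U can be
        used.\<close>
      also have "\<dots> = (\<Sum>p'<length ts'. if p' = p then
          (\<Sum>a'<m. conjugate_rep G (ts' ! p) \<sigma> h $$ (a, a') * U $$ (p' * m + a', q * n + b)) else 0)"
        using p by simp
      also have "\<dots> = (\<Sum>p'<length ts'. \<Sum>a'<m. ?S h $$ (p * m + a, p' * m + a') * U $$ (p' * m + a', q * n + b))"
        by (intro sum.cong refl) (simp add: blockS[OF a])
      also have "\<dots> = (?S h * U) $$ (p * m + a, q * n + b)"
        by (rule mult_mat_index_blocks[symmetric, OF _ _ pa qb])
          (use rep_carrier_mat[OF is_group D(2) hG] Uc Dm in simp_all)
      also have "\<dots> = (U * ?R h) $$ (p * m + a, q * n + b)"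
        using inter[OF hG] by simp
      also have "\<dots> = (\<Sum>q'<length ts. \<Sum>b'<n. U $$ (p * m + a, q' * n + b') * ?R h $$ (q' * n + b', q * n + b))"
        by (rule mult_mat_index_blocks[OF _ _ pa qb])
          (use rep_carrier_mat[OF is_group D(1) hG] Uc Dn in simp_all)
      also have "\<dots> = (\<Sum>q'<length ts. if q' = q then
          (\<Sum>b'<n. U $$ (p * m + a, q' * n + b') * conjugate_rep G (ts ! q) \<rho> h $$ (b', b)) else 0)"
        by (intro sum.cong refl) (simp add: blockR[OF b])
      also have "\<dots> = (\<Sum>b'<n. U $$ (p * m + a, q * n + b') * conjugate_rep G (ts ! q) \<rho> h $$ (b', b))"
        using q by simp
      also have "\<dots> = (M * conjugate_rep G (ts ! q) \<rho> h) $$ (a, b)"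
        using \<rho>h a b by (simp add: scalar_prod_def lessThan_atLeast0 M_def)
      finally show "(conjugate_rep G (ts' ! p) \<sigma> h * M) $$ (a, b) = (M * conjugate_rep G (ts ! q) \<rho> h) $$ (a, b)" .
    qed (use M \<sigma>h \<rho>h in auto)
  qed
  then show ?thesis by (rule that[OF tq tp])
qed

text \<open>From left to right, one concrete induced representation lies in both sets, so some
  conjugates of c and c' by t and s coincide, and \<open>inv s \<otimes> t\<close> takes c to c'.
  The transversal guarantees that there is such an element to compare.\<close>

lemma Ind_eq_iff:
  assumes fin: "\<exists>ts. left_transversal G H ts"
    and c: "c \<in> dual (G\<lparr>carrier := H\<rparr>)" and c': "c' \<in> dual (G\<lparr>carrier := H\<rparr>)"
  shows "Ind G H c = Ind G H c' \<longleftrightarrow> (\<exists>g\<in>carrier G. conjugate_class g c = c')"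
proof
  assume eq: "Ind G H c = Ind G H c'"
  obtain ts where ts: "left_transversal G H ts" using fin by blast
  obtain \<rho> where \<rho>: "\<rho> \<in> c" using dual_nonempty[OF group_H c] .
  obtain n where "\<rho> \<in> hom (G\<lparr>carrier := H\<rparr>) (unitary_grp n)"
    using dual_memD(1)[OF group_H c \<rho>] by (auto simp: irreducible_rep_def)
  then have "ind_rep G H ts \<rho> \<in> reps G"
    using ind_rep_hom[OF is_group is_subgroup ts] by (auto simp: reps_def)
  then have "(ind_rep G H ts \<rho>, ind_rep G H ts \<rho>) \<in> rep_equiv G"
    using equiv_rep_equiv[OF is_group] by (meson equivE refl_onD)
  then have "ind_rep G H ts \<rho> \<in> Ind G H c'"
    using ts \<rho> eq by (auto simp: mem_Ind_iff)
  then obtain ts' \<sigma> where ts': "left_transversal G H ts'" and \<sigma>: "\<sigma> \<in> c'"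
    and *: "(ind_rep G H ts' \<sigma>, ind_rep G H ts \<rho>) \<in> rep_equiv G"
    by (auto simp: mem_Ind_iff)
  obtain s t where st: "s \<in> carrier G" "t \<in> carrier G"
    and **: "(conjugate_rep G s \<sigma>, conjugate_rep G t \<rho>) \<in> rep_equiv (G\<lparr>carrier := H\<rparr>)"
    using ind_rep_equivD[OF ts' ts dual_memD(1)[OF group_H c' \<sigma>] dual_memD(1)[OF group_H c \<rho>] *] .
  have "conjugate_class t c = conjugate_class s c'"
    using equiv_class_eq[OF equiv_H **] conjugate_class_eq[OF st(1) c' \<sigma>] conjugate_class_eq[OF st(2) c \<rho>]
    by simp
  then have "conjugate_class (inv s) (conjugate_class t c) = conjugate_class (inv s) (conjugate_class s c')"
    by simp
  then have "conjugate_class (inv s \<otimes> t) c = c'"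
    using st c c' by (simp add: conjugate_class_mult conjugate_class_one)
  then show "\<exists>g\<in>carrier G. conjugate_class g c = c'" using st by blast
next
  assume "\<exists>g\<in>carrier G. conjugate_class g c = c'"
  then show "Ind G H c = Ind G H c'" using Ind_conjugate_class[OF _ c] by blast
qed

end

section \<open>Finiteness of the point group\<close>

lemma euclid_simps:
  "carrier (euclid d) = orth_mats d \<times> carrier_vec d"
  "(A, a) \<otimes>\<^bsub>euclid d\<^esub> (B, b) = (A * B, a + A *\<^sub>v b)"
  "\<one>\<^bsub>euclid d\<^esub> = (1\<^sub>m d, 0\<^sub>v d)"
  by (simp_all add: euclid_def)

lemma orth_mats_carrier: "A \<in> orth_mats d \<Longrightarrow> A \<in> carrier_mat d d"
  by (simp add: orth_mats_def)

lemma orth_mats_right: "A \<in> orth_mats d \<Longrightarrow> A * transpose_mat A = 1\<^sub>m d"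
  by (simp add: orth_mats_def)

lemma one_orth_mats: "1\<^sub>m d \<in> orth_mats d"
  by (simp add: orth_mats_def)

lemma orth_mats_scalar_prod:
  assumes A: "A \<in> orth_mats d" and v: "v \<in> carrier_vec d"
  shows "(A *\<^sub>v v) \<bullet> (A *\<^sub>v v) = v \<bullet> v"
proof -
  note Ac = orth_mats_carrier[OF A]
  have "(transpose_mat A *\<^sub>v (A *\<^sub>v v)) \<bullet> v = (A *\<^sub>v v) \<bullet> (A *\<^sub>v v)"
    using transpose_vec_mult_scalar[OF Ac v] Ac v by simp
  moreover have "transpose_mat A *\<^sub>v (A *\<^sub>v v) = v"
    using assoc_mult_mat_vec[of "transpose_mat A" d d A d v] orth_mats_transpose[OF A] Ac v by simp
  ultimately show ?thesis by simp
qed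

lemma abs_index_le_sqrt_scalar_prod:
  assumes "i < dim_vec (v :: real vec)"
  shows "\<bar>v $ i\<bar> \<le> sqrt (v \<bullet> v)"
proof -
  have "(v $ i)\<^sup>2 \<le> v \<bullet> v"
    unfolding scalar_prod_def power2_eq_square using assms
    by (intro member_le_sum[of i _ "\<lambda>i. v $ i * v $ i"]) auto
  then show ?thesis by (simp add: real_le_rsqrt)
qed

text \<open>Space is cut into cubes of side e. Points in the same cube differ by less than e in
  every coordinate, hence are equal by separation of differences, and a bounded box meets only
  finitely many cubes.\<close>

lemma finite_bounded_lattice:
  fixes \<Lambda> :: "real vec set"
  assumes \<Lambda>: "\<Lambda> \<subseteq> carrier_vec d" and diff: "\<And>u v. u \<in> \<Lambda> \<Longrightarrow> v \<in> \<Lambda> \<Longrightarrow> u - v \<in> \<Lambda>"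
    and e: "e > 0" and sep: "\<And>v. v \<in> \<Lambda> \<Longrightarrow> (\<And>i. i < d \<Longrightarrow> \<bar>v $ i\<bar> < e) \<Longrightarrow> v = 0\<^sub>v d"
  shows "finite {v \<in> \<Lambda>. \<forall>i<d. \<bar>v $ i\<bar> \<le> r}"
proof -
  define f where "f v = map (\<lambda>i. \<lfloor>v $ i / e\<rfloor>) [0..<d]" for v :: "real vec"
  have "inj_on f \<Lambda>"
  proof (rule inj_onI)
    fix u v assume uv: "u \<in> \<Lambda>" "v \<in> \<Lambda>" and eq: "f u = f v"
    have c: "u \<in> carrier_vec d" "v \<in> carrier_vec d" using uv \<Lambda> by auto
    have "\<bar>(u - v) $ i\<bar> < e" if i: "i < d" for i
    proof -
      have fl: "\<lfloor>u $ i / e\<rfloor> = \<lfloor>v $ i / e\<rfloor>" using eq i by (simp add: f_def)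
      have "\<bar>u $ i / e - v $ i / e\<bar> < 1"
        using fl floor_correct[of "u $ i / e"] floor_correct[of "v $ i / e"] by linarith
      then have "\<bar>u $ i - v $ i\<bar> / e < 1" using e by (simp add: abs_divide diff_divide_distrib[symmetric])
      then show ?thesis using e i c by simp
    qed
    then have "u - v = 0\<^sub>v d" by (rule sep[OF diff[OF uv]])
    then have "(u - v) $ i = 0" if "i < d" for i using that by simp
    then show "u = v" using c by (intro eq_vecI) auto
  qed
  moreover have "f ` {v \<in> \<Lambda>. \<forall>i<d. \<bar>v $ i\<bar> \<le> r} \<subseteq> {xs. set xs \<subseteq> {\<lfloor>- r / e\<rfloor>..\<lfloor>r / e\<rfloor>} \<and> length xs = d}"
  proof (intro image_subsetI CollectI conjI subsetI)
    fix v z assume v: "v \<in> {v \<in> \<Lambda>. \<forall>i<d. \<bar>v $ i\<bar> \<le> r}" and "z \<in> set (f v)"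
    then obtain i where i: "i < d" "z = \<lfloor>v $ i / e\<rfloor>" by (auto simp: f_def)
    have "- r \<le> v $ i" "v $ i \<le> r" using v i by (auto simp: abs_le_iff)
    then have "- r / e \<le> v $ i / e" "v $ i / e \<le> r / e"
      using e by (intro divide_right_mono; simp)+
    then show "z \<in> {\<lfloor>- r / e\<rfloor>..\<lfloor>r / e\<rfloor>}"
      unfolding i atLeastAtMost_iff by (intro conjI floor_mono)
  qed (simp add: f_def)
  then have "finite (f ` {v \<in> \<Lambda>. \<forall>i<d. \<bar>v $ i\<bar> \<le> r})"
    by (rule finite_subset) (simp add: finite_lists_length_eq)
  ultimately show ?thesis
    by (metis (no_types, lifting) finite_imageD inj_on_subset mem_Collect_eq subsetI)
qed

text \<open>The vectors on which A and B agree form a subspace, and d independent vectors span the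
  whole space.\<close>

lemma mat_eq_on_basis:
  fixes A B :: "real mat"
  assumes A: "A \<in> carrier_mat d d" and B: "B \<in> carrier_mat d d"
    and S: "S \<subseteq> carrier_vec d" "finite S" "card S = d"
      "\<not> module.lin_dep class_ring (module_vec TYPE(real) d) S"
    and eq: "\<And>v. v \<in> S \<Longrightarrow> A *\<^sub>v v = B *\<^sub>v v"
  shows "A = B"
proof -
  interpret vec_space "TYPE(real)" d .
  have "basis S"
    using S by (intro dim_li_is_basis) (auto simp: dim_is_n)
  then have span: "span S = carrier_vec d" by (simp add: basis_def)
  let ?W = "{v \<in> carrier_vec d. A *\<^sub>v v = B *\<^sub>v v}"
  have "VectorSpace.subspace class_ring ?W (module_vec TYPE(real) d)"
    using A B by (intro subspace_module_vecI)
      (auto simp: mult_add_distrib_mat_vec[OF A] mult_add_distrib_mat_vec[OF B] mult_mat_vec[OF A] mult_mat_vec[OF B])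
  then have "submodule class_ring ?W V" by (rule is_module)
  then have "span S \<subseteq> ?W" using eq S(1) by (intro span_is_subset) auto
  then show ?thesis using span by (intro mat_eqI_mult_vec[OF A B]) auto
qed

text \<open>Linear parts preserve both the translation lattice and lengths. Each is determined by
  its values on d independent translation vectors, and each such value is one of finitely many
  lattice vectors of bounded size.\<close>

lemma finite_point_group:
  assumes sg: "space_group d X"
  shows "finite (lin_part ` X)"
proof -
  interpret E: group "euclid d" by (rule group_euclid)
  have X: "subgroup X (euclid d)" and disc: "discrete_isometries d X"
    using sg by (auto simp: space_group_def)
  obtain S where S: "S \<subseteq> trans_part ` translations_of d X" "finite S" "card S = d"
    "\<not> module.lin_dep class_ring (module_vec TYPE(real) d) S"
    using sg by (auto simp: space_group_def)
  define \<Lambda> where "\<Lambda> = trans_part ` translations_of d X"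
  have \<Lambda>_iff: "v \<in> \<Lambda> \<longleftrightarrow> (1\<^sub>m d, v) \<in> X" for v
    by (force simp: \<Lambda>_def translations_of_def)
  have XE: "g \<in> orth_mats d \<times> carrier_vec d" if "g \<in> X" for g
    using subgroup.mem_carrier[OF X that] by (simp add: euclid_simps)
  have \<Lambda>c: "\<Lambda> \<subseteq> carrier_vec d" using XE by (auto simp: \<Lambda>_iff)
  have diff: "u - v \<in> \<Lambda>" if "u \<in> \<Lambda>" "v \<in> \<Lambda>" for u v
  proof -
    have uv: "(1\<^sub>m d, u) \<in> X" "(1\<^sub>m d, v) \<in> X" "u \<in> carrier_vec d" "v \<in> carrier_vec d"
      using that \<Lambda>c by (auto simp: \<Lambda>_iff)
    have "inv\<^bsub>euclid d\<^esub> (1\<^sub>m d, v) = (1\<^sub>m d, - v)"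
      using uv by (intro E.inv_equality) (auto simp: euclid_simps one_orth_mats)
    moreover have "(1\<^sub>m d, u) \<otimes>\<^bsub>euclid d\<^esub> inv\<^bsub>euclid d\<^esub> (1\<^sub>m d, v) \<in> X"
      using X uv by (simp add: subgroup.m_closed subgroup.m_inv_closed)
    ultimately show ?thesis using uv by (simp add: euclid_simps \<Lambda>_iff minus_add_uminus_vec)
  qed
  have one: "(1\<^sub>m d, 0\<^sub>v d) \<in> X" using subgroup.one_closed[OF X] by (simp add: euclid_simps)
  \<comment> \<open>Discreteness at the identity separates all lattice vectors by the same e,
    because their differences are lattice vectors again.\<close>
  obtain e where e: "e > 0" and sep: "\<forall>h\<in>X.
      (\<forall>i<d. \<forall>j<d. \<bar>lin_part h $$ (i, j) - lin_part (1\<^sub>m d, 0\<^sub>v d :: real vec) $$ (i, j)\<bar> < e) \<and>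
      (\<forall>i<d. \<bar>trans_part h $ i - trans_part (1\<^sub>m d :: real mat, 0\<^sub>v d) $ i\<bar> < e) \<longrightarrow> h = (1\<^sub>m d, 0\<^sub>v d)"
    using bspec[OF disc[unfolded discrete_isometries_def] one] by blast
  have fin: "finite {v \<in> \<Lambda>. \<forall>i<d. \<bar>v $ i\<bar> \<le> r}" for r
  proof (rule finite_bounded_lattice[OF \<Lambda>c diff e])
    fix v assume "v \<in> \<Lambda>" "\<And>i. i < d \<Longrightarrow> \<bar>v $ i\<bar> < e"
    then show "v = 0\<^sub>v d" using bspec[OF sep, of "(1\<^sub>m d, v)"] e by (simp add: \<Lambda>_iff)
  qed
  \<comment> \<open>Conjugating the translation by v with \<open>(A, a)\<close> yields the
    translation by A v.\<close>
  have act: "A *\<^sub>v v \<in> \<Lambda>" if "A \<in> lin_part ` X" "v \<in> \<Lambda>" for A v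
  proof -
    from that obtain a where s: "(A, a) \<in> X" by force
    have v: "(1\<^sub>m d, v) \<in> X" using that by (simp add: \<Lambda>_iff)
    have c: "A \<in> orth_mats d" "A \<in> carrier_mat d d" "a \<in> carrier_vec d" "v \<in> carrier_vec d"
      using XE[OF s] XE[OF v] by (auto dest: orth_mats_carrier)
    have E: "(A, a) \<in> carrier (euclid d)" "(1\<^sub>m d, v) \<in> carrier (euclid d)" "(1\<^sub>m d, A *\<^sub>v v) \<in> carrier (euclid d)"
      using c by (auto simp: euclid_simps one_orth_mats)
    have "(1\<^sub>m d, A *\<^sub>v v) \<otimes>\<^bsub>euclid d\<^esub> (A, a) = (A, a) \<otimes>\<^bsub>euclid d\<^esub> (1\<^sub>m d, v)"
      using c comm_add_vec[of a d "A *\<^sub>v v"] by (simp add: euclid_simps)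
    then have "(1\<^sub>m d, A *\<^sub>v v) = (A, a) \<otimes>\<^bsub>euclid d\<^esub> (1\<^sub>m d, v) \<otimes>\<^bsub>euclid d\<^esub> inv\<^bsub>euclid d\<^esub> (A, a)"
      using E E.inv_solve_right[of "(1\<^sub>m d, A *\<^sub>v v)" "(A, a) \<otimes>\<^bsub>euclid d\<^esub> (1\<^sub>m d, v)" "(A, a)"]
        E.m_closed[OF E(1,2)] by simp
    also have "\<dots> \<in> X" using X s v by (simp add: subgroup.m_closed subgroup.m_inv_closed)
    finally show ?thesis by (simp add: \<Lambda>_iff)
  qed
  have orth: "A \<in> orth_mats d" if "A \<in> lin_part ` X" for A using XE that by auto
  \<comment> \<open>Restricted to \<open>S\<close>, so that the values lie in an extensional product
    of finite sets.\<close>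
  define F where "F A = (\<lambda>v\<in>S. A *\<^sub>v v)" for A :: "real mat"
  have SL: "S \<subseteq> \<Lambda>" using S(1) by (simp add: \<Lambda>_def)
  have "inj_on F (lin_part ` X)"
  proof (rule inj_onI)
    fix A B assume AB: "A \<in> lin_part ` X" "B \<in> lin_part ` X" "F A = F B"
    then have "A *\<^sub>v v = B *\<^sub>v v" if "v \<in> S" for v
      using that by (metis F_def restrict_apply')
    then show "A = B"
      using mat_eq_on_basis[OF orth_mats_carrier orth_mats_carrier, of A d B S] orth AB S SL \<Lambda>c by blast
  qed
  \<comment> \<open>The bound is the length of v, which A preserves and which dominates every
    coordinate of the image.\<close>
  moreover have "F ` lin_part ` X \<subseteq> (\<Pi>\<^sub>E v\<in>S. {u \<in> \<Lambda>. \<forall>i<d. \<bar>u $ i\<bar> \<le> sqrt (v \<bullet> v)})"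
  proof (intro image_subsetI PiE_I)
    fix A v assume s: "A \<in> lin_part ` X" and v: "v \<in> S"
    have A: "A \<in> orth_mats d" and vc: "v \<in> carrier_vec d" and "A *\<^sub>v v \<in> \<Lambda>"
      using orth act s v SL \<Lambda>c by auto
    moreover have "\<bar>(A *\<^sub>v v) $ i\<bar> \<le> sqrt (v \<bullet> v)" if "i < d" for i
      using abs_index_le_sqrt_scalar_prod[of i "A *\<^sub>v v"] orth_mats_scalar_prod[OF A vc]
        orth_mats_carrier[OF A] that by auto
    ultimately show "F A v \<in> {u \<in> \<Lambda>. \<forall>i<d. \<bar>u $ i\<bar> \<le> sqrt (v \<bullet> v)}"
      using v by (simp add: F_def)
  qed (simp add: F_def)
  then have "finite (F ` lin_part ` X)"
    using finite_PiE[OF S(2) fin] by (rule finite_subset)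
  ultimately show ?thesis using finite_imageD by blast
qed

text \<open>The fibres of f are the left cosets of K, so one preimage for each of its finitely many
  values represents every coset once.\<close>

lemma (in group) left_transversal_exists:
  assumes K: "subgroup K G" and fin: "finite (f ` carrier G)"
    and f: "\<And>t x. t \<in> carrier G \<Longrightarrow> x \<in> carrier G \<Longrightarrow> inv t \<otimes> x \<in> K \<longleftrightarrow> f t = f x"
  shows "\<exists>ts. left_transversal G K ts"
proof -
  \<comment> \<open>The values are listed without repetition, because
    \<open>left_transversal\<close> requires a unique index and not merely a unique
    representative.\<close>
  obtain vs where vs: "distinct vs" "set vs = f ` carrier G"
    using finite_distinct_list[OF fin] by blast
  define ts where "ts = map (inv_into (carrier G) f) vs"
  have ts: "ts ! i \<in> carrier G" "f (ts ! i) = vs ! i" if "i < length vs" for i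
  proof -
    have "vs ! i \<in> f ` carrier G" using that vs(2) nth_mem by blast
    then show "ts ! i \<in> carrier G" "f (ts ! i) = vs ! i"
      using that by (simp_all add: ts_def inv_into_into f_inv_into_f)
  qed
  have "left_transversal G K ts"
    unfolding left_transversal_def
  proof (intro conjI ballI)
    show "set ts \<subseteq> carrier G" using ts by (auto simp: in_set_conv_nth ts_def)
    fix x assume x: "x \<in> carrier G"
    have "x \<in> (ts ! i) <# K \<longleftrightarrow> vs ! i = f x" if "i < length vs" for i
      using in_l_coset_iff[OF K ts(1)[OF that] x] f[OF ts(1)[OF that] x] ts(2)[OF that] by simp
    moreover have "\<exists>!i. i < length vs \<and> vs ! i = f x"
    proof -
      have "f x \<in> set vs" using vs(2) x by simp
      then show ?thesis using vs(1) by (metis in_set_conv_nth nth_eq_iff_index_eq)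
    qed
    ultimately show "\<exists>!i. i < length ts \<and> x \<in> (ts ! i) <# K"
      by (simp add: ts_def cong: conj_cong)
  qed
  then show ?thesis by blast
qed

section \<open>The projection to the space group\<close>

text \<open>Both factors are block diagonal with vanishing first translation coordinates. This shape
  persists under products, so the second components multiply independently of the first.\<close>

lemma proj_mult:
  assumes X: "X \<subseteq> carrier (euclid d2)" and x: "x \<in> orth_dsum d1 d2 X" and y: "y \<in> orth_dsum d1 d2 X"
  shows "proj d1 d2 (x \<otimes>\<^bsub>euclid (d1 + d2)\<^esub> y) = proj d1 d2 x \<otimes>\<^bsub>euclid d2\<^esub> proj d1 d2 y"
proof -
  from x obtain A g where x: "A \<in> orth_mats d1" "g \<in> X" "x = iso_dsum d1 d2 A g"
    by (auto simp: orth_dsum_def)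
  from y obtain B h where y: "B \<in> orth_mats d1" "h \<in> X" "y = iso_dsum d1 d2 B h"
    by (auto simp: orth_dsum_def)
  obtain C a where g: "g = (C, a)" by force
  obtain D b where h: "h = (D, b)" by force
  have c: "A \<in> carrier_mat d1 d1" "B \<in> carrier_mat d1 d1" "C \<in> carrier_mat d2 d2" "D \<in> carrier_mat d2 d2"
    "a \<in> carrier_vec d2" "b \<in> carrier_vec d2"
    using x(1) y(1) subsetD[OF X x(2)] subsetD[OF X y(2)] by (auto simp: g h euclid_simps orth_mats_carrier)
  have lin: "four_block_mat A (0\<^sub>m d1 d2) (0\<^sub>m d2 d1) C * four_block_mat B (0\<^sub>m d1 d2) (0\<^sub>m d2 d1) D =
      four_block_mat (A * B) (0\<^sub>m d1 d2) (0\<^sub>m d2 d1) (C * D)"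
    using c mult_four_block_mat[OF c(1) zero_carrier_mat zero_carrier_mat c(3) c(2) zero_carrier_mat zero_carrier_mat c(4)]
    by simp
  have "four_block_mat A (0\<^sub>m d1 d2) (0\<^sub>m d2 d1) C *\<^sub>v (0\<^sub>v d1 @\<^sub>v b) = 0\<^sub>v d1 @\<^sub>v (C *\<^sub>v b)"
  proof -
    have "A *\<^sub>v 0\<^sub>v d1 = 0\<^sub>v d1" "0\<^sub>m d1 d2 *\<^sub>v b = 0\<^sub>v d1" "0\<^sub>m d2 d1 *\<^sub>v 0\<^sub>v d1 = (0\<^sub>v d2 :: real vec)"
      using c by (auto intro!: eq_vecI)
    then show ?thesis
      using c four_block_mat_mult_vec[OF c(1) zero_carrier_mat zero_carrier_mat c(3) zero_carrier_vec c(6)]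
        mult_mat_vec_carrier[OF c(3,6)] by simp
  qed
  then have "x \<otimes>\<^bsub>euclid (d1 + d2)\<^esub> y = iso_dsum d1 d2 (A * B) (g \<otimes>\<^bsub>euclid d2\<^esub> h)"
    using c lin append_vec_add[of "0\<^sub>v d1" d1 "0\<^sub>v d1" a d2 "C *\<^sub>v b"] mult_mat_vec_carrier[OF c(3,6)]
    by (simp add: x(3) y(3) g h iso_dsum_def euclid_simps)
  then show ?thesis
    using c mult_mat_vec_carrier[OF c(3,6)] mult_carrier_mat[OF c(1,2)] mult_carrier_mat[OF c(3,4)]
    by (simp add: x(3) y(3) proj_iso_dsum g h euclid_simps)
qed

text \<open>N is described as the kernel of the linear part, from which normality and the index can
  be read off.\<close>

locale space_group_extension =
  fixes d1 d2 :: nat and \<S> \<G> N :: "isometry set"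
  assumes S: "space_group d2 \<S>"
    and G: "subgroup \<G> (euclid (d1 + d2))"
    and sub: "\<G> \<subseteq> orth_dsum d1 d2 \<S>"
    and surj: "proj d1 d2 ` \<G> = \<S>"
    and N_def: "N = {x \<in> \<G>. lin_part (proj d1 d2 x) = 1\<^sub>m d2}"
begin

abbreviation "EG \<equiv> subgrp (d1 + d2) \<G>"
abbreviation "p \<equiv> proj d1 d2"
abbreviation "L x \<equiv> lin_part (p x)"

lemma subgroup_S: "subgroup \<S> (euclid d2)"
  using S by (simp add: space_group_def)

lemma group_EG: "group EG"
  using subgroup.subgroup_is_group[OF G group_euclid] .

lemma inv_EG: "x \<in> \<G> \<Longrightarrow> inv\<^bsub>EG\<^esub> x = inv\<^bsub>euclid (d1 + d2)\<^esub> x"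
  using group.m_inv_consistent[OF group_euclid G] by simp

lemma p_closed: "x \<in> \<G> \<Longrightarrow> p x \<in> \<S>"
  using surj by blast

lemma p_cases:
  assumes "x \<in> \<G>"
  obtains A a where "p x = (A, a)" "A \<in> orth_mats d2" "A \<in> carrier_mat d2 d2" "a \<in> carrier_vec d2"
proof -
  have "p x \<in> orth_mats d2 \<times> carrier_vec d2"
    using subgroup.mem_carrier[OF subgroup_S p_closed[OF assms]] by (simp add: euclid_simps)
  then show ?thesis using that orth_mats_carrier by (cases "p x") auto
qed

lemma L_orth: "x \<in> \<G> \<Longrightarrow> L x \<in> orth_mats d2"
  by (rule p_cases[of x]) auto

lemma L_carrier: "x \<in> \<G> \<Longrightarrow> L x \<in> carrier_mat d2 d2"
  using L_orth orth_mats_carrier by blast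

lemma p_mult: "x \<in> \<G> \<Longrightarrow> y \<in> \<G> \<Longrightarrow> p (x \<otimes>\<^bsub>euclid (d1 + d2)\<^esub> y) = p x \<otimes>\<^bsub>euclid d2\<^esub> p y"
  by (rule proj_mult[OF subgroup.subset[OF subgroup_S]]) (use sub in auto)

lemma p_hom: "p \<in> hom EG (euclid d2)"
  using p_mult subgroup.mem_carrier[OF subgroup_S p_closed] by (intro homI) auto

lemma p_one: "p \<one>\<^bsub>euclid (d1 + d2)\<^esub> = (1\<^sub>m d2, 0\<^sub>v d2)"
  using hom_one[OF p_hom group_EG group_euclid] by (simp add: euclid_simps)

lemma L_mult: "x \<in> \<G> \<Longrightarrow> y \<in> \<G> \<Longrightarrow> L (x \<otimes>\<^bsub>euclid (d1 + d2)\<^esub> y) = L x * L y"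
  by (cases "p x"; cases "p y") (simp add: p_mult euclid_simps)

lemma inv_closed_G: "x \<in> \<G> \<Longrightarrow> inv\<^bsub>EG\<^esub> x \<in> \<G>"
  using group.inv_closed[OF group_EG, of x] by simp

lemma L_inv:
  assumes x: "x \<in> \<G>"
  shows "L (inv\<^bsub>EG\<^esub> x) = transpose_mat (L x)"
proof -
  note c = L_carrier[OF x] L_carrier[OF inv_closed_G[OF x]]
  have "L x * L (inv\<^bsub>EG\<^esub> x) = 1\<^sub>m d2"
    using L_mult[OF x inv_closed_G[OF x]] group.r_inv[OF group_EG, of x] x p_one by simp
  then have "transpose_mat (L x) * (L x * L (inv\<^bsub>EG\<^esub> x)) = transpose_mat (L x)"
    using c by simp
  moreover have "transpose_mat (L x) * (L x * L (inv\<^bsub>EG\<^esub> x)) = (transpose_mat (L x) * L x) * L (inv\<^bsub>EG\<^esub> x)"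
    using c by (intro assoc_mult_mat[symmetric]) auto
  ultimately show ?thesis using orth_mats_transpose[OF L_orth[OF x]] c by simp
qed

lemma mult_closed_G: "x \<in> \<G> \<Longrightarrow> y \<in> \<G> \<Longrightarrow> x \<otimes>\<^bsub>euclid (d1 + d2)\<^esub> y \<in> \<G>"
  using subgroup.m_closed[OF G] by simp

lemma mem_N_iff: "x \<in> N \<longleftrightarrow> x \<in> \<G> \<and> L x = 1\<^sub>m d2"
  by (simp add: N_def)

text \<open>The cosets of N are the fibres of L, as \<open>left_transversal_exists\<close>
  requires.\<close>

lemma inv_mult_mem_N_iff:
  assumes "t \<in> \<G>" "x \<in> \<G>"
  shows "inv\<^bsub>EG\<^esub> t \<otimes>\<^bsub>euclid (d1 + d2)\<^esub> x \<in> N \<longleftrightarrow> L t = L x"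
proof -
  note c = L_carrier[OF assms(1)] L_carrier[OF assms(2)]
  have eq: "L (inv\<^bsub>EG\<^esub> t \<otimes>\<^bsub>euclid (d1 + d2)\<^esub> x) = transpose_mat (L t) * L x"
    using assms L_mult[OF inv_closed_G[OF assms(1)] assms(2)] L_inv[OF assms(1)] by simp
  have "transpose_mat (L t) * L x = 1\<^sub>m d2 \<longleftrightarrow> L t = L x"
  proof
    assume "transpose_mat (L t) * L x = 1\<^sub>m d2"
    then have "L t * (transpose_mat (L t) * L x) = L t" using c by simp
    moreover have "L t * (transpose_mat (L t) * L x) = (L t * transpose_mat (L t)) * L x"
      using c by (intro assoc_mult_mat[symmetric]) auto
    ultimately show "L t = L x" using orth_mats_right[OF L_orth[OF assms(1)]] c by simp
  qed (use orth_mats_transpose[OF L_orth[OF assms(2)]] in simp)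
  then show ?thesis
    using mult_closed_G[OF inv_closed_G[OF assms(1)] assms(2)] by (simp add: mem_N_iff eq)
qed

sublocale normal N EG
proof -
  interpret EG: group EG by (rule group_EG)
  have "subgroup N EG"
  proof (rule EG.subgroupI)
    show "N \<noteq> {}" using p_one EG.one_closed mem_N_iff[of "\<one>\<^bsub>EG\<^esub>"] by auto
    show "inv\<^bsub>EG\<^esub> x \<in> N" if "x \<in> N" for x
      using that inv_closed_G[of x] L_inv[of x] by (simp add: mem_N_iff)
    show "x \<otimes>\<^bsub>EG\<^esub> y \<in> N" if "x \<in> N" "y \<in> N" for x y
      using that mult_closed_G[of x y] L_mult[of x y] by (simp add: mem_N_iff)
  qed (auto simp: mem_N_iff)
  moreover have "g \<otimes>\<^bsub>EG\<^esub> x \<otimes>\<^bsub>EG\<^esub> inv\<^bsub>EG\<^esub> g \<in> N" if g: "g \<in> carrier EG" and x: "x \<in> N" for g x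
  proof -
    from g x have g: "g \<in> \<G>" and x: "x \<in> \<G>" "L x = 1\<^sub>m d2" by (auto simp: mem_N_iff)
    have "L (g \<otimes>\<^bsub>EG\<^esub> x \<otimes>\<^bsub>EG\<^esub> inv\<^bsub>EG\<^esub> g) = L g * 1\<^sub>m d2 * transpose_mat (L g)"
      using L_mult[OF mult_closed_G[OF g x(1)] inv_closed_G[OF g]] L_mult[OF g x(1)] L_inv[OF g] x(2) by simp
    also have "\<dots> = 1\<^sub>m d2" using orth_mats_right[OF L_orth[OF g]] L_carrier[OF g] by simp
    finally show ?thesis
      using mult_closed_G[OF mult_closed_G[OF g x(1)] inv_closed_G[OF g]] by (simp add: mem_N_iff)
  qed
  ultimately show "N \<lhd> EG" by (auto simp: EG.normal_inv_iff)
qed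

lemma transversal_exists: "\<exists>ts. left_transversal EG N ts"
proof (rule left_transversal_exists[OF is_subgroup])
  have "L ` carrier EG = lin_part ` \<S>" using surj by (simp add: image_image[symmetric])
  then show "finite (L ` carrier EG)" using finite_point_group[OF S] by simp
qed (use inv_mult_mem_N_iff in simp)

end

section \<open>Twists by characters\<close>

lemma smult_unitary:
  assumes "U \<in> carrier (unitary_grp n)" "c * cnj c = 1"
  shows "c \<cdot>\<^sub>m U \<in> carrier (unitary_grp n)"
proof -
  note U = unitary_carrier_mat[OF assms(1)]
  have "c \<cdot>\<^sub>m U * mat_adjoint (c \<cdot>\<^sub>m U) = (c * cnj c) \<cdot>\<^sub>m (U * mat_adjoint U)"
    using U mat_adjoint_carrier[OF U]
    by (simp add: mat_adjoint_smult mult_smult_distrib[of _ n n] mult_smult_assoc_mat[of _ n n] smult_smult_mat mult.commute)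
  then show ?thesis using U assms unitary_right[OF assms(1)] by (simp add: unitary_grp_def one_smult_mat)
qed

lemma chi_add:
  assumes "k \<in> carrier_vec d2" "l \<in> carrier_vec d2"
  shows "chi d1 d2 (k + l) x = chi d1 d2 k x * chi d1 d2 l x"
  using assms
  by (simp add: chi_def proj_def add_scalar_prod_distrib[of _ d2] distrib_left flip: exp_add)

lemma chi_zero: "chi d1 d2 (0\<^sub>v d2) x = 1"
  by (simp add: chi_def proj_def)

lemma chi_cnj: "chi d1 d2 k x * cnj (chi d1 d2 k x) = 1"
proof -
  have "cmod (chi d1 d2 k x) = 1" by (simp add: chi_def norm_exp_eq_Re)
  then show ?thesis by (metis complex_norm_square of_real_1 one_power2)
qed

context space_group_extension
begin

abbreviation "K \<equiv> subgrp (d1 + d2) N"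

lemma restrict_EG: "EG\<lparr>carrier := N\<rparr> = K"
  by simp

lemmas group_K = group_H[unfolded restrict_EG]

lemma p_cases_N:
  assumes "x \<in> N"
  obtains a where "p x = (1\<^sub>m d2, a)" "a \<in> carrier_vec d2"
proof -
  from assms have x: "x \<in> \<G>" "L x = 1\<^sub>m d2" by (auto simp: mem_N_iff)
  show ?thesis by (rule p_cases[OF x(1)]) (use x(2) that in auto)
qed

text \<open>On N the linear parts are trivial, so translation parts add under products.\<close>

lemma chi_mult:
  assumes k: "k \<in> carrier_vec d2" and x: "x \<in> N" and y: "y \<in> N"
  shows "chi d1 d2 k (x \<otimes>\<^bsub>K\<^esub> y) = chi d1 d2 k x * chi d1 d2 k y"
proof -
  obtain a where a: "p x = (1\<^sub>m d2, a)" "a \<in> carrier_vec d2" using p_cases_N[OF x] .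
  obtain b where b: "p y = (1\<^sub>m d2, b)" "b \<in> carrier_vec d2" using p_cases_N[OF y] .
  have "p (x \<otimes>\<^bsub>K\<^esub> y) = (1\<^sub>m d2, a + b)"
    using p_mult[of x y] x y a b by (simp add: mem_N_iff euclid_simps)
  then show ?thesis
    using k a b by (simp add: chi_def scalar_prod_add_distrib[of _ d2] distrib_left flip: exp_add)
qed

text \<open>Let b and c be the translation parts of x and of its conjugate, and A the linear part of
  g. Projecting g times the conjugate = x g gives A c = b, without computing the inverse of g.
  Orthogonality then turns the pairing of k with c into that of A k with b.\<close>

lemma chi_conj:
  assumes k: "k \<in> carrier_vec d2" and x: "x \<in> N" and g: "g \<in> \<G>"
  shows "chi d1 d2 k (inv\<^bsub>EG\<^esub> g \<otimes>\<^bsub>EG\<^esub> x \<otimes>\<^bsub>EG\<^esub> g) = chi d1 d2 (L g *\<^sub>v k) x"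
proof -
  let ?h = "inv\<^bsub>EG\<^esub> g \<otimes>\<^bsub>EG\<^esub> x \<otimes>\<^bsub>EG\<^esub> g"
  from x have xG: "x \<in> \<G>" by (simp add: mem_N_iff)
  obtain b where b: "p x = (1\<^sub>m d2, b)" "b \<in> carrier_vec d2" using p_cases_N[OF x] .
  obtain A a where A: "p g = (A, a)" "A \<in> orth_mats d2" "A \<in> carrier_mat d2 d2" "a \<in> carrier_vec d2"
    using p_cases[OF g] .
  have h: "?h \<in> \<G>" using g xG by (simp add: mult_closed_G inv_closed_G)
  obtain C c where C: "p ?h = (C, c)" "C \<in> carrier_mat d2 d2" "c \<in> carrier_vec d2"
    by (rule p_cases[OF h])
  have "g \<otimes>\<^bsub>EG\<^esub> ?h = (g \<otimes>\<^bsub>EG\<^esub> inv\<^bsub>EG\<^esub> g) \<otimes>\<^bsub>EG\<^esub> x \<otimes>\<^bsub>EG\<^esub> g"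
    by (subst (1 2 3) m_assoc) (use g xG in \<open>simp_all add: mult_closed_G inv_closed_G\<close>)
  also have "\<dots> = x \<otimes>\<^bsub>EG\<^esub> g"
    using r_inv[of g] l_one[of x] g xG by simp
  finally have "p g \<otimes>\<^bsub>euclid d2\<^esub> p ?h = p x \<otimes>\<^bsub>euclid d2\<^esub> p g"
    using p_mult[OF g h] p_mult[OF xG g] by simp
  then have "a + A *\<^sub>v c = b + a" using A C b by (simp add: euclid_simps)
  then have "A *\<^sub>v c + a = b + a" using A C comm_add_vec[of a d2 "A *\<^sub>v c"] by simp
  then have sum_eq: "(A *\<^sub>v c + a) $ i = (b + a) $ i" for i by simp
  have Ac: "A *\<^sub>v c = b"
  proof (rule eq_vecI)
    show "(A *\<^sub>v c) $ i = b $ i" if "i < dim_vec b" for i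
      using sum_eq[of i] that A(4) b(2) by simp
  qed (use A(3) b(2) in auto)
  have "(transpose_mat A *\<^sub>v (A *\<^sub>v k)) \<bullet> c = (A *\<^sub>v k) \<bullet> (A *\<^sub>v c)"
    using A C k by (intro transpose_vec_mult_scalar) auto
  moreover have "transpose_mat A *\<^sub>v (A *\<^sub>v k) = k"
    using assoc_mult_mat_vec[of "transpose_mat A" d2 d2 A d2 k] orth_mats_transpose[OF A(2)] A(3) k by simp
  ultimately have "k \<bullet> c = (A *\<^sub>v k) \<bullet> b" using Ac by simp
  then show ?thesis by (simp only: chi_def C(1) A(1) b(1) fst_conv snd_conv)
qed

section \<open>Twisted representations and their classes\<close>

lemma twist_rep_hom:
  assumes k: "k \<in> carrier_vec d2" and \<rho>: "\<rho> \<in> hom K (unitary_grp n)"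
  shows "twist_rep d1 d2 k \<rho> \<in> hom K (unitary_grp n)"
proof (rule homI)
  fix x assume "x \<in> carrier K"
  then show "twist_rep d1 d2 k \<rho> x \<in> carrier (unitary_grp n)"
    using rep_closed[OF group_K \<rho>] chi_cnj smult_unitary by (simp add: twist_rep_def)
next
  fix x y assume xy: "x \<in> carrier K" "y \<in> carrier K"
  note c = rep_carrier_mat[OF group_K \<rho> xy(1)] rep_carrier_mat[OF group_K \<rho> xy(2)]
  have "twist_rep d1 d2 k \<rho> (x \<otimes>\<^bsub>K\<^esub> y) = (chi d1 d2 k x * chi d1 d2 k y) \<cdot>\<^sub>m (\<rho> x * \<rho> y)"
    using chi_mult[OF k] rep_mult[OF group_K \<rho> xy] xy unfolding twist_rep_def by simp
  also have "\<dots> = twist_rep d1 d2 k \<rho> x * twist_rep d1 d2 k \<rho> y"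
    using c by (simp add: twist_rep_def mult_smult_distrib[of _ n n] mult_smult_assoc_mat[of _ n n] smult_smult_mat mult.commute)
  finally show "twist_rep d1 d2 k \<rho> (x \<otimes>\<^bsub>K\<^esub> y) =
      twist_rep d1 d2 k \<rho> x \<otimes>\<^bsub>unitary_grp n\<^esub> twist_rep d1 d2 k \<rho> y" by simp
qed

lemma twist_rep_equiv:
  assumes k: "k \<in> carrier_vec d2" and eq: "(\<rho>, \<sigma>) \<in> rep_equiv K"
  shows "(twist_rep d1 d2 k \<rho>, twist_rep d1 d2 k \<sigma>) \<in> rep_equiv K"
proof -
  from eq obtain n U where *: "\<rho> \<in> hom K (unitary_grp n)" "\<sigma> \<in> hom K (unitary_grp n)"
    "U \<in> carrier (unitary_grp n)" "\<And>h. h \<in> carrier K \<Longrightarrow> \<sigma> h = U * \<rho> h * mat_adjoint U"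
    unfolding rep_equiv_def by blast
  show ?thesis
  proof (rule rep_equivI[OF twist_rep_hom[OF k *(1)] twist_rep_hom[OF k *(2)] *(3)])
    fix h assume h: "h \<in> carrier K"
    note c = rep_carrier_mat[OF group_K *(1) h] unitary_carrier_mat[OF *(3)]
    show "twist_rep d1 d2 k \<sigma> h = U * twist_rep d1 d2 k \<rho> h * mat_adjoint U"
      using c mult_carrier_mat[OF c(2,1)] mat_adjoint_carrier[OF c(2)]
      by (simp add: twist_rep_def *(4)[OF h] mult_smult_distrib[of _ n n] mult_smult_assoc_mat[of _ n n])
  qed
qed

lemma irreducible_twist_rep:
  assumes k: "k \<in> carrier_vec d2" and irr: "irreducible_rep K \<rho>"
  shows "irreducible_rep K (twist_rep d1 d2 k \<rho>)"
proof -
  obtain n where \<rho>: "\<rho> \<in> hom K (unitary_grp n)" using irr by (auto simp: irreducible_rep_def)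
  \<comment> \<open>Values of \<open>chi\<close> have modulus 1, so the conjugate scalar undoes the
    twist.\<close>
  have "\<rho> h = cnj (chi d1 d2 k h) \<cdot>\<^sub>m twist_rep d1 d2 k \<rho> h" for h
    using chi_cnj[of d1 d2 k h] by (simp add: twist_rep_def smult_smult_mat mult.commute one_smult_mat)
  then show ?thesis
    by (intro irreducible_rep_transfer[OF group_K irr \<rho> twist_rep_hom[OF k \<rho>]]) blast
qed

abbreviation "cj \<equiv> conj_class (d1 + d2) N"
abbreviation "tw \<equiv> twist_class d1 d2 N"

lemma cj_eq:
  assumes "g \<in> \<G>"
  shows "cj g = conjugate_class g"
proof -
  have "conj_rep (d1 + d2) g = conjugate_rep EG g"
    using inv_EG[OF assms] by (intro ext) (simp add: conj_rep_def conjugate_rep_def)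
  then show ?thesis by (simp add: conj_class_def)
qed

lemma tw_dual:
  assumes "k \<in> carrier_vec d2" "c \<in> dual K"
  shows "tw k c \<in> dual K"
    and "\<rho> \<in> c \<Longrightarrow> tw k c = rep_equiv K `` {twist_rep d1 d2 k \<rho>}"
    and "\<rho> \<in> c \<Longrightarrow> twist_rep d1 d2 k \<rho> \<in> tw k c"
proof -
  note * = on_classes_dual[OF group_K assms(2) _ irreducible_twist_rep[OF assms(1)] twist_rep_equiv[OF assms(1)]]
  obtain \<sigma> where "\<sigma> \<in> c" using dual_nonempty[OF group_K assms(2)] .
  then show "tw k c \<in> dual K" unfolding twist_class_def by (rule *(2))
  show "\<rho> \<in> c \<Longrightarrow> tw k c = rep_equiv K `` {twist_rep d1 d2 k \<rho>}" unfolding twist_class_def by (rule *(1))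
  show "\<rho> \<in> c \<Longrightarrow> twist_rep d1 d2 k \<rho> \<in> tw k c" unfolding twist_class_def by (rule *(3))
qed

lemma cj_dual:
  assumes "g \<in> \<G>" "c \<in> dual K"
  shows "cj g c \<in> dual K"
    and "\<rho> \<in> c \<Longrightarrow> cj g c = rep_equiv K `` {conjugate_rep EG g \<rho>}"
    and "\<rho> \<in> c \<Longrightarrow> conjugate_rep EG g \<rho> \<in> cj g c"
  using conjugate_class_dual[unfolded restrict_EG, of g c] assms by (simp_all add: cj_eq)

lemma tw_add:
  assumes k: "k \<in> carrier_vec d2" and l: "l \<in> carrier_vec d2" and c: "c \<in> dual K"
  shows "tw k (tw l c) = tw (k + l) c"
proof -
  obtain \<rho> where \<rho>: "\<rho> \<in> c" using dual_nonempty[OF group_K c] .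
  have "twist_rep d1 d2 k (twist_rep d1 d2 l \<rho>) = twist_rep d1 d2 (k + l) \<rho>"
    by (rule ext) (simp add: twist_rep_def smult_smult_mat chi_add[OF k l])
  then show ?thesis
    using tw_dual(2)[OF k tw_dual(1)[OF l c] tw_dual(3)[OF l c \<rho>]] tw_dual(2)[OF _ c \<rho>, of "k + l"] k l
    by simp
qed

lemma tw_zero:
  assumes c: "c \<in> dual K"
  shows "tw (0\<^sub>v d2) c = c"
proof -
  obtain \<rho> where \<rho>: "\<rho> \<in> c" using dual_nonempty[OF group_K c] .
  have "twist_rep d1 d2 (0\<^sub>v d2) \<rho> = \<rho>"
    by (rule ext) (simp add: twist_rep_def chi_zero one_smult_mat)
  then show ?thesis
    using tw_dual(2)[OF zero_carrier_vec c \<rho>] dual_memD(2)[OF group_K c \<rho>] by simp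
qed

lemma cj_tw:
  assumes g: "g \<in> \<G>" and k: "k \<in> carrier_vec d2" and c: "c \<in> dual K"
  shows "cj g (tw k c) = tw (L g *\<^sub>v k) (cj g c)"
proof -
  obtain \<rho> where \<rho>: "\<rho> \<in> c" using dual_nonempty[OF group_K c] .
  have Lk: "L g *\<^sub>v k \<in> carrier_vec d2" using mult_mat_vec_carrier[OF L_carrier[OF g] k] .
  have "twist_rep d1 d2 (L g *\<^sub>v k) (conjugate_rep EG g \<rho>) x = conjugate_rep EG g (twist_rep d1 d2 k \<rho>) x"
    if "x \<in> N" for x
    using chi_conj[OF k that g] by (simp only: twist_rep_def conjugate_rep_def)
  moreover have "conjugate_rep EG g (twist_rep d1 d2 k \<rho>) \<in> reps K"
    using cj_dual(3)[OF g tw_dual(1)[OF k c] tw_dual(3)[OF k c \<rho>]] cj_dual(1)[OF g tw_dual(1)[OF k c]]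
      dual_memD(1)[OF group_K] irreducible_rep_in_reps by blast
  ultimately have "(conjugate_rep EG g (twist_rep d1 d2 k \<rho>), twist_rep d1 d2 (L g *\<^sub>v k) (conjugate_rep EG g \<rho>)) \<in> rep_equiv K"
    by (intro rep_equiv_of_eq[OF group_K]) auto
  then show ?thesis
    using cj_dual(2)[OF g tw_dual(1)[OF k c] tw_dual(3)[OF k c \<rho>]]
      tw_dual(2)[OF Lk cj_dual(1)[OF g c] cj_dual(3)[OF g c \<rho>]] equiv_class_eq[OF equiv_rep_equiv[OF group_K]]
    by simp
qed

text \<open>Twisting is an action of the additive group of vectors, so the twist by k can be
  cancelled by \<open>- k\<close>.\<close>

lemma tw_eq_iff:
  assumes k: "k \<in> carrier_vec d2" and l: "l \<in> carrier_vec d2" and c: "c \<in> dual K" "c' \<in> dual K"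
  shows "tw k c = tw l c' \<longleftrightarrow> c = tw (l - k) c'"
proof
  assume "tw k c = tw l c'"
  then have "tw (- k) (tw k c) = tw (- k) (tw l c')" by simp
  moreover have "- k + l = l - k" using k l by (intro eq_vecI) auto
  ultimately show "c = tw (l - k) c'" using k l c by (simp add: tw_add tw_zero)
next
  assume *: "c = tw (l - k) c'"
  have "k + (l - k) = l" using k l by (intro eq_vecI) auto
  then show "tw k c = tw l c'" using k l c unfolding * by (simp add: tw_add)
qed

lemma Ind_tw_eq_iff:
  assumes k: "k \<in> carrier_vec d2" "k' \<in> carrier_vec d2" and c: "c \<in> dual K" "c' \<in> dual K"
  shows "Ind EG N (tw k c) = Ind EG N (tw k' c') \<longleftrightarrow> (\<exists>g\<in>\<G>. cj g c = tw (k' - L g *\<^sub>v k) c')"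
proof -
  have "Ind EG N (tw k c) = Ind EG N (tw k' c') \<longleftrightarrow> (\<exists>g\<in>\<G>. cj g (tw k c) = tw k' c')"
    using Ind_eq_iff[OF transversal_exists, unfolded restrict_EG, OF tw_dual(1)[OF k(1) c(1)] tw_dual(1)[OF k(2) c(2)]]
      cj_eq by simp
  \<comment> \<open>For each g, the twist by k leaves the conjugate as a twist by
    \<open>L g *\<^sub>v k\<close>, which is then moved to the other side.\<close>
  also have "\<dots> \<longleftrightarrow> (\<exists>g\<in>\<G>. cj g c = tw (k' - L g *\<^sub>v k) c')"
    using tw_eq_iff[OF mult_mat_vec_carrier[OF L_carrier k(1)] k(2) cj_dual(1)[OF _ c(1)] c(2)]
      cj_tw[OF _ k(1) c(1)] by (intro bex_cong refl) simp
  finally show ?thesis .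
qed

text \<open>
  The orbits are thus the fibres of \<open>k \<mapsto> Ind (\<chi>\<^sub>k \<rho>)\<close>, which makes the map
  well-defined and injective for fixed \<open>\<rho>\<close>.
\<close>
lemma euclid_orbit_eq:
  assumes k: "k \<in> carrier_vec d2" and c: "c \<in> dual K"
  shows "euclid_orbit (G_rho d1 d2 \<G> N c) k =
    {l \<in> carrier_vec d2. Ind EG N (tw l c) = Ind EG N (tw k c)}"
proof (intro equalityI subsetI)
  fix l assume "l \<in> euclid_orbit (G_rho d1 d2 \<G> N c) k"
  then obtain g m where g: "g \<in> \<G>" "m \<in> carrier_vec d2" "cj g c = tw m c" "l = L g *\<^sub>v k + m"
    by (auto simp: euclid_orbit_def G_rho_def euclid_act_def)
  have Lk: "L g *\<^sub>v k \<in> carrier_vec d2" using mult_mat_vec_carrier[OF L_carrier[OF g(1)] k] .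
  have l: "l \<in> carrier_vec d2" using Lk g by simp
  \<comment> \<open>The translation part of an element of \<open>G_rho\<close> that sends k to l is
    the very twist occurring in \<open>Ind_tw_eq_iff\<close>.\<close>
  have "l - L g *\<^sub>v k = m" using g(2) L_carrier[OF g(1)] unfolding g(4) by (intro eq_vecI) auto
  then have "cj g c = tw (l - L g *\<^sub>v k) c" using g(3) by simp
  then have "Ind EG N (tw k c) = Ind EG N (tw l c)" using Ind_tw_eq_iff[OF k l c c] g(1) by blast
  then show "l \<in> {l \<in> carrier_vec d2. Ind EG N (tw l c) = Ind EG N (tw k c)}" using l by simp
next
  fix l assume "l \<in> {l \<in> carrier_vec d2. Ind EG N (tw l c) = Ind EG N (tw k c)}"
  then have l: "l \<in> carrier_vec d2" and "Ind EG N (tw k c) = Ind EG N (tw l c)" by auto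
  then obtain g where g: "g \<in> \<G>" "cj g c = tw (l - L g *\<^sub>v k) c"
    using Ind_tw_eq_iff[OF k l c c] by blast
  have Lk: "L g *\<^sub>v k \<in> carrier_vec d2" using mult_mat_vec_carrier[OF L_carrier[OF g(1)] k] .
  \<comment> \<open>Conversely, the twist provided by \<open>Ind_tw_eq_iff\<close> is the
    translation part that makes \<open>L g\<close> send k to l.\<close>
  have "(L g, l - L g *\<^sub>v k) \<in> G_rho d1 d2 \<G> N c" 
    using g minus_carrier_vec[OF l Lk] unfolding G_rho_def by blast
  moreover have "l = euclid_act (L g, l - L g *\<^sub>v k) k"
    using l L_carrier[OF g(1)] by (intro eq_vecI) (auto simp: euclid_act_def)
  ultimately show "l \<in> euclid_orbit (G_rho d1 d2 \<G> N c) k" unfolding euclid_orbit_def by blast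
qed

text \<open>Witnessed by the unit and the zero vector. It places each element of R in its own class,
  to which uniqueness of representatives is applied.\<close>

lemma dual_sim_refl:
  assumes c: "c \<in> dual K"
  shows "(c, c) \<in> dual_sim d1 d2 \<G> N"
proof -
  have "cj \<one>\<^bsub>EG\<^esub> c = tw (0\<^sub>v d2) c"
    using conjugate_class_one[unfolded restrict_EG, OF c] cj_eq[of "\<one>\<^bsub>EG\<^esub>"] one_closed tw_zero[OF c] by simp
  then show ?thesis
    using c one_closed zero_carrier_vec[of d2] unfolding dual_sim_def by fastforce
qed

lemma orbits_bij_Ind:
  assumes R: "R \<subseteq> dual K"
    and unique: "\<forall>X \<in> dual K // dual_sim d1 d2 \<G> N. \<exists>!\<rho>. \<rho> \<in> R \<inter> X"
  shows "\<exists>\<Phi>. (\<forall>\<rho>\<in>R. \<forall>k\<in>carrier_vec d2.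
        \<Phi> (euclid_orbit (G_rho d1 d2 \<G> N \<rho>) k, \<rho>) = Ind EG N (tw k \<rho>)) \<and>
      bij_betw \<Phi> {(X, \<rho>). \<rho> \<in> R \<and> X \<in> euclid_orbits d2 (G_rho d1 d2 \<G> N \<rho>)} (Ind EG N ` dual K)"
proof -
  let ?orb = "\<lambda>\<rho>. euclid_orbit (G_rho d1 d2 \<G> N \<rho>)"
  let ?D = "{(X, \<rho>). \<rho> \<in> R \<and> X \<in> euclid_orbits d2 (G_rho d1 d2 \<G> N \<rho>)}"
  \<comment> \<open>An arbitrary point of the orbit is chosen; by \<open>euclid_orbit_eq\<close> all
    points of an orbit have the same induced class.\<close>
  define \<Phi> where "\<Phi> = (\<lambda>(X, \<rho>). Ind EG N (tw (SOME k. k \<in> X) \<rho>))"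
  have \<Phi>: "\<Phi> (?orb \<rho> k, \<rho>) = Ind EG N (tw k \<rho>)" if \<rho>: "\<rho> \<in> R" and k: "k \<in> carrier_vec d2" for \<rho> k
  proof -
    have orb: "?orb \<rho> k = {l \<in> carrier_vec d2. Ind EG N (tw l \<rho>) = Ind EG N (tw k \<rho>)}"
      using euclid_orbit_eq[OF k] \<rho> R by blast
    have "(SOME l. l \<in> ?orb \<rho> k) \<in> ?orb \<rho> k"
      by (rule someI[of _ k]) (simp add: orb k)
    then show ?thesis unfolding \<Phi>_def prod.case using orb by blast
  qed
  have D_cases: "\<exists>k\<in>carrier_vec d2. X = ?orb \<rho> k" if "(X, \<rho>) \<in> ?D" for X \<rho>
    using that by (auto simp: euclid_orbits_def)
  have "bij_betw \<Phi> ?D (Ind EG N ` dual K)"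
  proof (rule bij_betw_imageI)
    show "inj_on \<Phi> ?D"
    proof (rule inj_onI)
      fix P Q assume PQ: "P \<in> ?D" "Q \<in> ?D" "\<Phi> P = \<Phi> Q"
      obtain X \<rho> Y \<sigma> where P: "P = (X, \<rho>)" "Q = (Y, \<sigma>)" by (metis surj_pair)
      have \<rho>: "\<rho> \<in> R" "\<rho> \<in> dual K" and \<sigma>: "\<sigma> \<in> R" "\<sigma> \<in> dual K" using PQ R P by auto
      obtain k where k: "k \<in> carrier_vec d2" "X = ?orb \<rho> k" using D_cases PQ(1) unfolding P by blast
      obtain l where l: "l \<in> carrier_vec d2" "Y = ?orb \<sigma> l" using D_cases PQ(2) unfolding P by blast
      have eq: "Ind EG N (tw k \<rho>) = Ind EG N (tw l \<sigma>)"
        using PQ(3) \<Phi>[OF \<rho>(1) k(1)] \<Phi>[OF \<sigma>(1) l(1)] by (simp add: P k(2) l(2))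
      then obtain g where g: "g \<in> \<G>" "cj g \<rho> = tw (l - L g *\<^sub>v k) \<sigma>"
        using Ind_tw_eq_iff[OF k(1) l(1) \<rho>(2) \<sigma>(2)] by blast
      have "l - L g *\<^sub>v k \<in> carrier_vec d2"
        using l(1) mult_mat_vec_carrier[OF L_carrier[OF g(1)] k(1)] by simp
      then have "(\<rho>, \<sigma>) \<in> dual_sim d1 d2 \<G> N" using g \<rho>(2) \<sigma>(2) unfolding dual_sim_def by blast
      \<comment> \<open>Both \<rho> and \<sigma> now belong to R and to the class of \<rho>, so they
        coincide. Both orbits are then the same fibre.\<close>
      then have sim: "\<sigma> \<in> R \<inter> dual_sim d1 d2 \<G> N `` {\<rho>}" using \<sigma>(1) by simp
      have "dual_sim d1 d2 \<G> N `` {\<rho>} \<in> dual K // dual_sim d1 d2 \<G> N"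
        using \<rho>(2) by (rule quotientI)
      then have "\<exists>!\<tau>. \<tau> \<in> R \<inter> dual_sim d1 d2 \<G> N `` {\<rho>}" by (rule bspec[OF unique])
      moreover have "\<rho> \<in> R \<inter> dual_sim d1 d2 \<G> N `` {\<rho>}" using \<rho>(1) dual_sim_refl[OF \<rho>(2)] by simp
      ultimately have "\<rho> = \<sigma>" using sim by metis
      then show "P = Q"
        using eq euclid_orbit_eq[OF k(1) \<rho>(2)] euclid_orbit_eq[OF l(1) \<sigma>(2)] by (simp add: P k(2) l(2))
    qed
    show "\<Phi> ` ?D = Ind EG N ` dual K"
    proof (intro equalityI subsetI)
      fix z assume "z \<in> \<Phi> ` ?D"
      then obtain X \<rho> where X: "(X, \<rho>) \<in> ?D" "z = \<Phi> (X, \<rho>)" by auto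
      then obtain k where k: "k \<in> carrier_vec d2" "X = ?orb \<rho> k" using D_cases by blast
      have "\<rho> \<in> R" "\<rho> \<in> dual K" using X(1) R by auto
      then show "z \<in> Ind EG N ` dual K" using X(2) k \<Phi> tw_dual(1) by auto
    next
      fix z assume "z \<in> Ind EG N ` dual K"
      then obtain c where c: "c \<in> dual K" "z = Ind EG N c" by blast
      have "dual_sim d1 d2 \<G> N `` {c} \<in> dual K // dual_sim d1 d2 \<G> N"
        using c(1) by (rule quotientI)
      then have "\<exists>!\<rho>. \<rho> \<in> R \<inter> dual_sim d1 d2 \<G> N `` {c}" by (rule bspec[OF unique])
      then obtain \<rho> where "\<rho> \<in> R \<inter> dual_sim d1 d2 \<G> N `` {c}" by (rule ex1E)
      then have \<rho>: "\<rho> \<in> R" "(c, \<rho>) \<in> dual_sim d1 d2 \<G> N" by simp_all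
      then obtain g k where g: "g \<in> \<G>" "k \<in> carrier_vec d2" "cj g c = tw k \<rho>"
        unfolding dual_sim_def by blast
      \<comment> \<open>Induction does not see the conjugation by which c differs from a twist of
        its representative in R.\<close>
      have "z = Ind EG N (cj g c)"
        using Ind_conjugate_class[unfolded restrict_EG, of g c] g(1) c cj_eq[OF g(1)] by simp
      also have "\<dots> = \<Phi> (?orb \<rho> k, \<rho>)" using \<Phi>[OF \<rho>(1) g(2)] g(3) by simp
      finally show "z \<in> \<Phi> ` ?D" using \<rho>(1) g(2) by (auto simp: euclid_orbits_def)
    qed
  qed
  with \<Phi> show ?thesis by blast
qed

end

theorem theorem4p16:
  fixes d d1 d2 :: nat
    and \<S> \<G> \<F> \<T> TF :: "isometry set"
    and R :: "isometry rep_class set"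
  assumes "d \<ge> 1" and "d = d1 + d2"
    and "space_group d2 \<S>"
    and "subgroup \<G> (euclid d)" and "discrete_isometries d \<G>"
    and "\<G> \<subseteq> orth_dsum d1 d2 \<S>"
    and "proj d1 d2 ` \<G> = \<S>"
    and "\<F> = kernel (subgrp d \<G>) (subgrp d2 \<S>) (proj d1 d2)"
    and "\<T> \<subseteq> \<G>" and "bij_betw (proj d1 d2) \<T> (translations_of d2 \<S>)"
    and "TF = \<T> <#>\<^bsub>euclid d\<^esub> \<F>"
    and "R \<subseteq> dual (subgrp d TF)"
    and "\<forall>X \<in> dual (subgrp d TF) // dual_sim d1 d2 \<G> TF. \<exists>!\<rho>. \<rho> \<in> R \<inter> X"
  shows "\<exists>\<Phi> :: real vec set \<times> isometry rep_class \<Rightarrow> isometry rep_class.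
      (\<forall>\<rho> \<in> R. \<forall>k \<in> carrier_vec d2.
         \<Phi> (euclid_orbit (G_rho d1 d2 \<G> TF \<rho>) k, \<rho>)
           = Ind (subgrp d \<G>) TF (twist_class d1 d2 TF k \<rho>)) \<and>
      bij_betw \<Phi>
        {(X, \<rho>). \<rho> \<in> R \<and> X \<in> euclid_orbits d2 (G_rho d1 d2 \<G> TF \<rho>)}
        (Ind (subgrp d \<G>) TF ` dual (subgrp d TF))"
proof -
  note d = assms(2)
  interpret E: space_group_extension d1 d2 \<S> \<G> "{x \<in> \<G>. lin_part (proj d1 d2 x) = 1\<^sub>m d2}"
    using assms(3,4,6,7) by (intro space_group_extension.intro) (simp_all add: d)
  have F: "x \<in> \<F> \<longleftrightarrow> x \<in> \<G> \<and> E.p x = (1\<^sub>m d2, 0\<^sub>v d2)" for x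
    using assms(8) by (auto simp: kernel_def euclid_simps)
  \<comment> \<open>\<T> contains one element over each translation of \<S>, and \<F> fills up the
    fibres of the projection, so the product is the full preimage of the translations.\<close>
  have "TF = {x \<in> \<G>. lin_part (proj d1 d2 x) = 1\<^sub>m d2}"
  proof (intro equalityI subsetI)
    fix x assume "x \<in> TF"
    then obtain t f where x: "t \<in> \<T>" "f \<in> \<F>" "x = t \<otimes>\<^bsub>E.EG\<^esub> f"
      using assms(11) by (auto simp: set_mult_def d)
    have "E.p t \<in> translations_of d2 \<S>" using assms(10) x(1) by (auto simp: bij_betw_def)
    then have "E.L t = 1\<^sub>m d2" by (simp add: translations_of_def)
    moreover have tf: "t \<in> \<G>" "f \<in> \<G>" "E.L f = 1\<^sub>m d2" using x F assms(9) by auto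
    ultimately have "E.L x = 1\<^sub>m d2" using E.L_mult[OF tf(1,2)] x(3) by simp
    then show "x \<in> {x \<in> \<G>. lin_part (proj d1 d2 x) = 1\<^sub>m d2}"
      using E.mult_closed_G[OF tf(1,2)] x(3) by simp
  next
    fix x assume "x \<in> {x \<in> \<G>. lin_part (proj d1 d2 x) = 1\<^sub>m d2}"
    then have x: "x \<in> \<G>" "E.L x = 1\<^sub>m d2" by auto
    then have "E.p x \<in> translations_of d2 \<S>" using E.p_closed by (simp add: translations_of_def)
    then obtain t where t: "t \<in> \<T>" "E.p t = E.p x" using assms(10) by (metis bij_betw_imp_surj_on imageE)
    have tG: "t \<in> \<G>" using t assms(9) by blast
    \<comment> \<open>Since t and x have the same projection, this quotient projects to the identity
      and therefore lies in \<F>.\<close>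
    let ?f = "inv\<^bsub>E.EG\<^esub> t \<otimes>\<^bsub>E.EG\<^esub> x"
    have "E.p ?f = E.p (inv\<^bsub>E.EG\<^esub> t \<otimes>\<^bsub>E.EG\<^esub> t)"
      using E.p_mult[OF E.inv_closed_G[OF tG]] x(1) tG t(2) by simp
    also have "\<dots> = (1\<^sub>m d2, 0\<^sub>v d2)" using E.l_inv[of t] tG E.p_one by simp
    finally have "?f \<in> \<F>" using F E.mult_closed_G[OF E.inv_closed_G[OF tG] x(1)] by simp
    moreover have "x = t \<otimes>\<^bsub>E.EG\<^esub> ?f"
      using E.m_assoc[of t "inv\<^bsub>E.EG\<^esub> t" x] E.r_inv[of t] E.l_one[of x] E.inv_closed_G[OF tG] tG x(1) by simp
    ultimately show "x \<in> TF" using t(1) assms(11) by (auto simp: set_mult_def d)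
  qed
  then show ?thesis using E.orbits_bij_Ind[of R] assms(12,13) by (simp only: d)
qed

end
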